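(* Let $d\ge2$ be an integer. There exists $0<\varepsilon=\varepsilon(d,\ell)\ll1$ such that for all $(\ell,r)$ in the range $$\Big(d\ge2,\ 0<\ell<d,\ r^*(d,\ell)-\varepsilon(d,\ell)<r<r^*(d,\ell)\Big)\quad\text{or}\quad\Big(d\in\{2,3\},\ \ell>d,\ r_+(d,\ell)-\varepsilon(d,\ell)<r<r_+(d,\ell)\Big)$$ there exists $c_r>0$ such that the $P_6$–$P_2$ trajectory $(\sigma(x),w(x))$ satisfies the following: with $F=\sigma+\sigma'$, for all points of the trajectory, i.e. for all $\sigma\ge\sigma(P_2)$, $$(1-w-w')^2-F^2\ge c_r,\qquad 1-w-w'-\frac{(1-w)F}{\sigma}\ge c_r,\qquad 1-w-w'\ge c_r.$$
   Context: $d\ge2$ integer, $\ell>0$, $r>1$, $w_e=\ell(r-1)/d$, $r^*(d,\ell)=\frac{d+\ell}{\ell+\sqrt d}$, $r_+(d,\ell)=1+\frac{d-1}{(1+\sqrt\ell)^2}$. The system considered is $\Delta w'=-\Delta_1$, $\Delta\sigma'=-\Delta_2$, $'=d/dx$, with $\Delta=(w-1)^2-\sigma^2$, $\Delta_1=w(w-1)(w-r)-d(w-w_e)\sigma^2$, $\Delta_2=\frac{\sigma}{\ell}\left[(\ell+d-1)w^2-(\ell+d+\ell r-r)w+\ell r-\ell\sigma^2\right]$. $P_2=(\sigma_2,w_2)=(1-w_-,w_-)$ (written as $(\sigma,w)$), where $w_-=\frac{1}{2(d-1)}\left(d-1+(\ell-1)(r-1)-\sqrt J\right)$, $J=(1-\ell)^2(r-1)^2-2(d-1)(\ell+1)(r-1)+(d-1)^2$.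 $P_6$ denotes the point at infinity $w=w_e$, $\sigma=+\infty$ (reached as $x\to-\infty$). For parameters in the stated range there is a unique trajectory joining $P_6$ to $P_2$: it is a graph $w=w(\sigma)$, $\sigma>\sigma_2$, with $w\to w_e$ as $\sigma\to+\infty$ and $w\to w_2$ as $\sigma\downarrow\sigma_2$, $P_2$ being reached at a finite value of $x$. Values of $w',\sigma'$ at $P_2$ are understood as limits along the trajectory. *)

theory Defs
  imports "HOL-Analysis.Analysis"
begin

text \<open>
  Throughout, \<open>d\<close> is the dimension, \<open>l\<close> and \<open>r\<close> are real parameters, and points of the phase
  plane are listed in the order \<open>(\<sigma>, w)\<close>.
\<close>

definition w_e :: "nat \<Rightarrow> real \<Rightarrow> real \<Rightarrow> real" where
  "w_e d l r = l * (r - 1) / real d"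

definition r_star :: "nat \<Rightarrow> real \<Rightarrow> real" where
  "r_star d l = (real d + l) / (l + sqrt (real d))"

definition r_plus :: "nat \<Rightarrow> real \<Rightarrow> real" where
  "r_plus d l = 1 + (real d - 1) / (1 + sqrt l)\<^sup>2"

definition Delta :: "real \<Rightarrow> real \<Rightarrow> real" where
  "Delta s w = (w - 1)\<^sup>2 - s\<^sup>2"

definition Delta1 :: "nat \<Rightarrow> real \<Rightarrow> real \<Rightarrow> real \<Rightarrow> real \<Rightarrow> real" where
  "Delta1 d l r s w = w * (w - 1) * (w - r) - real d * (w - w_e d l r) * s\<^sup>2"

definition Delta2 :: "nat \<Rightarrow> real \<Rightarrow> real \<Rightarrow> real \<Rightarrow> real \<Rightarrow> real" where
  "Delta2 d l r s w =
     s / l * ((l + real d - 1) * w\<^sup>2 - (l + real d + l * r - r) * w + l * r - l * s\<^sup>2)"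

definition J :: "nat \<Rightarrow> real \<Rightarrow> real \<Rightarrow> real" where
  "J d l r = (1 - l)\<^sup>2 * (r - 1)\<^sup>2 - 2 * (real d - 1) * (l + 1) * (r - 1) + (real d - 1)\<^sup>2"

definition w2 :: "nat \<Rightarrow> real \<Rightarrow> real \<Rightarrow> real" where
  "w2 d l r = (real d - 1 + (l - 1) * (r - 1) - sqrt (J d l r)) / (2 * (real d - 1))"

definition sigma2 :: "nat \<Rightarrow> real \<Rightarrow> real \<Rightarrow> real" where
  "sigma2 d l r = 1 - w2 d l r"

text \<open>
  A trajectory joining \<open>P\<^sub>6\<close> to \<open>P\<^sub>2\<close>, parametrised by \<open>x < x2\<close>, where \<open>x2\<close> is the finite value of
  \<open>x\<close> at which \<open>P\<^sub>2\<close> is reached; only the restrictions of \<open>\<sigma>\<close> and \<open>w\<close> to \<open>x < x2\<close> matter.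
  The last clause says that its orbit is a graph \<open>w = W(\<sigma>)\<close> over \<open>\<sigma> > \<sigma>\<^sub>2\<close>; that \<open>W\<close> tends to
  \<open>w_e\<close> at infinity and to \<open>w\<^sub>2\<close> at \<open>\<sigma>\<^sub>2\<close> then follows from the limits in \<open>x\<close>.
\<close>

definition P6_P2_trajectory ::
  "nat \<Rightarrow> real \<Rightarrow> real \<Rightarrow> real \<Rightarrow> (real \<Rightarrow> real) \<Rightarrow> (real \<Rightarrow> real) \<Rightarrow> bool" where
  "P6_P2_trajectory d l r x2 \<sigma> w \<longleftrightarrow>
     (\<forall>x<x2. \<sigma> differentiable (at x) \<and> w differentiable (at x) \<and>
        Delta (\<sigma> x) (w x) * deriv w x = - Delta1 d l r (\<sigma> x) (w x) \<and>
        Delta (\<sigma> x) (w x) * deriv \<sigma> x = - Delta2 d l r (\<sigma> x) (w x)) \<and>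
     filterlim \<sigma> at_top at_bot \<and> (w \<longlongrightarrow> w_e d l r) at_bot \<and>
     (\<sigma> \<longlongrightarrow> sigma2 d l r) (at_left x2) \<and> (w \<longlongrightarrow> w2 d l r) (at_left x2) \<and>
     (\<exists>W. (\<lambda>x. (\<sigma> x, w x)) ` {..<x2} = (\<lambda>s. (s, W s)) ` {sigma2 d l r<..})"

text \<open>Here \<open>s'\<close> and \<open>w'\<close> are the values of the derivatives at the point \<open>(s, w)\<close>.\<close>

definition repulsive :: "real \<Rightarrow> real \<Rightarrow> real \<Rightarrow> real \<Rightarrow> real \<Rightarrow> bool" where
  "repulsive c s w s' w' \<longleftrightarrow>
     (let F = s + s' in
        (1 - w - w')\<^sup>2 - F\<^sup>2 \<ge> c \<and>
        1 - w - w' - (1 - w) * F / s \<ge> c \<and>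
        1 - w - w' \<ge> c)"

definition admissible_range :: "nat \<Rightarrow> (real \<Rightarrow> real) \<Rightarrow> real \<Rightarrow> real \<Rightarrow> bool" where
  "admissible_range d \<epsilon> l r \<longleftrightarrow>
     (0 < l \<and> l < real d \<and> r_star d l - \<epsilon> l < r \<and> r < r_star d l) \<or>
     (d \<in> {2, 3} \<and> real d < l \<and> r_plus d l - \<epsilon> l < r \<and> r < r_plus d l)"

end

theory Submission imports Defs begin

text \<open>
  Write \<open>u = 1 - w\<close>, let \<open>q\<close> be the quadratic in \<open>w\<close> whose roots \<open>w\<^sub>2 < w\<^sub>3\<close> are the
  \<open>w\<close>-coordinates of the sonic points, and put \<open>G = q(w) / (\<sigma>\<^sup>2 - u\<^sup>2)\<close>. Dividing by
  \<open>\<Delta> = - (\<sigma>\<^sup>2 - u\<^sup>2)\<close> turns the system into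
  \<open>w' = u G - d (w - w\<^sub>e)\<close> and \<open>\<sigma>' = - \<sigma> + \<sigma> G / l\<close>. On the trajectory \<open>\<sigma> > u > 0\<close> and
  \<open>w\<^sub>e < w < w\<^sub>2\<close>, so \<open>G > 0\<close> and \<open>F = \<sigma> + \<sigma>' = \<sigma> G / l\<close> is positive. With
  \<open>A = 1 - w - w'\<close> one has \<open>A\<^sup>2 - F\<^sup>2 = (A - F) (A + F)\<close> and \<open>u F / \<sigma> \<le> F\<close>; hence a positive
  lower bound \<open>\<eta>\<close> for \<open>A - F\<close> gives all three inequalities (\<open>repulsiveI\<close>).

  Now \<open>A - F = P - G Q\<close> with \<open>P = u + d (w - w\<^sub>e)\<close> and \<open>Q = u + \<sigma> / l\<close>, so the claim is that the
  trajectory stays on one side of the curve \<open>G Q = P - \<eta>\<close>. It starts there, because at \<open>P\<^sub>6\<close>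
  \<open>G\<close> tends to \<open>0\<close> and \<open>P\<close> to \<open>1 - w\<^sub>e > \<eta>\<close>, and it cannot leave because the flow crosses the
  curve in one direction only (\<open>barrier_crossing\<close>). The direction of crossing is an inequality
  between real numbers, \<open>barrier_derivative_negative\<close>. The reason behind it: on the curve
  \<open>D = \<sigma> - u\<close> decays at the fixed rate \<open>D' = - D - \<eta>\<close>, whereas \<open>q\<close>, which vanishes linearly in
  \<open>y = w\<^sub>2 - w\<close>, decays at a rate of about \<open>w' / y\<close>, and this rate is the larger one as soon as
  \<open>w\<^sub>2 < w\<^sub>5\<close>, where \<open>w\<^sub>5 = l r / (d + l)\<close> belongs to the stationary point of the system off the
  sonic line. The margin \<open>w\<^sub>5 - w\<^sub>2\<close> pays for the shift \<open>\<eta>\<close> of the curve, which is therefore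
  explicit and the same for all trajectories.

  The inequality \<open>w\<^sub>2 < w\<^sub>5\<close> is where the range of \<open>r\<close> enters. For \<open>l < d\<close> and \<open>r < r\<^sup>*\<close> the
  number \<open>q(w\<^sub>5)\<close> is negative, so \<open>w\<^sub>5\<close> lies between \<open>w\<^sub>2\<close> and \<open>w\<^sub>3\<close>; for \<open>l > d\<close> and
  \<open>r < r\<^sub>+\<close> it lies to the right of the midpoint of \<open>w\<^sub>2\<close> and \<open>w\<^sub>3\<close>.

  At \<open>P\<^sub>2\<close> the quotient \<open>G\<close> becomes \<open>0 / 0\<close>, and the derivatives have limits there exactly if \<open>G\<close>
  has one. Close to \<open>P\<^sub>2\<close> the equation for \<open>G\<close> is \<open>y G' = G \<Phi>(G)\<close> up to a small error, \<open>\<Phi>\<close>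
  being a nonzero quadratic polynomial. So every level other than the roots of \<open>\<Phi>\<close> is eventually
  crossed in one direction only, and the bounded function \<open>G\<close> cannot oscillate
  (\<open>G_converges\<close>). The three inequalities then pass to the limit.
\<close>

section \<open>Level crossings of real functions\<close>

lemma stays_below_level:
  fixes f f' :: "real \<Rightarrow> real"
  assumes der: "\<And>x. a \<le> x \<Longrightarrow> x < b \<Longrightarrow> (f has_real_derivative f' x) (at x)"
    and start: "f a < c"
    and cross: "\<And>x. a < x \<Longrightarrow> x < b \<Longrightarrow> f x = c \<Longrightarrow> f' x < 0"
    and x: "a \<le> x" "x < b"
  shows "f x < c"
proof (rule ccontr)
  assume "\<not> f x < c"
  then have fx: "f x \<ge> c" by simp
  have cont: "continuous_on {a..x} f"
  proof (rule DERIV_continuous_on)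
    fix t assume "t \<in> {a..x}"
    then show "(f has_real_derivative f' t) (at t within {a..x})"
      using der[of t] x by (simp add: has_field_derivative_at_within)
  qed
  define Z where "Z = {t \<in> {a..x}. f t = c}"
  have "\<exists>t\<ge>a. t \<le> x \<and> f t = c"
    using start fx x by (intro IVT' cont) auto
  then have ne: "Z \<noteq> {}" by (auto simp: Z_def)
  have "closed Z"
    unfolding Z_def by (rule continuous_closed_preimage_constant[OF cont]) simp
  then have "compact Z"
    unfolding compact_eq_bounded_closed
    using bounded_subset[of "{a..x}" Z] by (simp add: Z_def subset_iff)
  then obtain p where p: "p \<in> Z" "\<And>t. t \<in> Z \<Longrightarrow> p \<le> t"
    using compact_attains_inf[OF _ ne] by blast
  have pa: "a < p" "p \<le> x" "f p = c"
  proof -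
    have "a \<le> p" "p \<le> x" "f p = c" using p(1) by (simp_all add: Z_def)
    moreover have "p \<noteq> a" using start \<open>f p = c\<close> by blast
    ultimately show "a < p" "p \<le> x" "f p = c" by simp_all
  qed
  have before: "f t < c" if t: "a \<le> t" "t < p" for t
  proof (rule ccontr)
    assume "\<not> f t < c"
    then have "\<exists>s\<ge>a. s \<le> t \<and> f s = c"
      using t pa start by (intro IVT' continuous_on_subset[OF cont]) auto
    then obtain s where s: "a \<le> s" "s \<le> t" "f s = c" by blast
    moreover have "s \<le> x" using s t pa by linarith
    ultimately have "s \<in> Z" by (simp add: Z_def)
    then have "p \<le> s" by (rule p(2))
    then show False using s t by linarith
  qed
  obtain e where e: "e > 0" "\<And>h. h > 0 \<Longrightarrow> h < e \<Longrightarrow> f p < f (p - h)"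
  proof -
    have "p < b" using pa x by linarith
    from DERIV_neg_dec_left[OF der cross, OF less_imp_le[OF pa(1)] this pa(1) this pa(3)]
    show ?thesis using that by blast
  qed
  define h where "h = min (e / 2) (p - a)"
  have "h > 0" "h < e" using e(1) pa by (simp_all add: h_def min_less_iff_disj)
  have "a \<le> p - h" using min.cobounded2[of "e / 2" "p - a"] by (simp add: h_def)
  show False using e(2)[of h] \<open>h > 0\<close> \<open>h < e\<close> \<open>a \<le> p - h\<close> before[of "p - h"] pa by linarith
qed

text \<open>
  A level that is crossed only downwards near \<open>b\<close> is met at most once there: after the first value
  below it, \<open>stays_below_level\<close> applies.
\<close>

lemma level_eventually_one_sided:
  fixes f f' :: "real \<Rightarrow> real"
  assumes der: "\<And>x. x < b \<Longrightarrow> (f has_real_derivative f' x) (at x)"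
    and cross: "\<forall>\<^sub>F x in at_left b. f x = g \<longrightarrow> f' x < 0"
  shows "(\<forall>\<^sub>F x in at_left b. f x < g) \<or> (\<forall>\<^sub>F x in at_left b. f x > g)"
proof -
  obtain a where a: "a < b" "\<And>x. a < x \<Longrightarrow> x < b \<Longrightarrow> f x = g \<Longrightarrow> f' x < 0"
    using cross unfolding eventually_at_left_field by metis
  show ?thesis
  proof (cases "\<exists>x0. a < x0 \<and> x0 < b \<and> f x0 < g")
    case True
    then obtain x0 where x0: "a < x0" "x0 < b" "f x0 < g" by blast
    have "f x < g" if "x0 < x" "x < b" for x
      by (rule stays_below_level[of x0 b f f' g x]) (use der a x0 that in auto)
    then show ?thesis unfolding eventually_at_left_field using x0 by blast
  next
    case False
    have "f x > g" if x: "a < x" "x < b" for x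
    proof (rule ccontr)
      assume "\<not> f x > g"
      then have "f x = g" using False x by force
      then obtain e where e: "e > 0" "\<And>h. h > 0 \<Longrightarrow> h < e \<Longrightarrow> f x > f (x + h)"
        using DERIV_neg_dec_right[OF der[of x]] a x by auto
      define h where "h = min (e / 2) ((b - x) / 2)"
      have "h > 0" "h < e" using e x by (auto simp: h_def)
      have "h \<le> (b - x) / 2" unfolding h_def by (rule min.cobounded2)
      then have "x + h < b" "f (x + h) < g"
        using e(2)[of h] \<open>f x = g\<close> \<open>h > 0\<close> \<open>h < e\<close> x by (auto simp: field_simps)
      then show False using False x \<open>h > 0\<close> by force
    qed
    then show ?thesis unfolding eventually_at_left_field using a by blast
  qed
qed

text \<open>
  A bounded function without a limit takes every value between its lower and its upper limit
  infinitely often, passing in both directions. It converges if this is excluded for all but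
  finitely many levels. The limit is the supremum of the levels that the function eventually
  exceeds.
\<close>

lemma converges_if_one_sided_levels:
  fixes f f' :: "real \<Rightarrow> real"
  assumes der: "\<And>x. x < b \<Longrightarrow> (f has_real_derivative f' x) (at x)"
    and lo: "\<forall>\<^sub>F x in at_left b. A < f x" and hi: "\<forall>\<^sub>F x in at_left b. f x < B"
    and fin: "finite Z"
    and cross: "\<And>g. A < g \<Longrightarrow> g \<notin> Z \<Longrightarrow>
      (\<forall>\<^sub>F x in at_left b. f x = g \<longrightarrow> f' x < 0) \<or> (\<forall>\<^sub>F x in at_left b. f x = g \<longrightarrow> f' x > 0)"
  shows "\<exists>L. (f \<longlongrightarrow> L) (at_left b)"
proof -
  have sides: "(\<forall>\<^sub>F x in at_left b. f x < g) \<or> (\<forall>\<^sub>F x in at_left b. f x > g)"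
    if g: "A < g" "g \<notin> Z" for g
    using cross[OF g]
  proof
    assume "\<forall>\<^sub>F x in at_left b. f x = g \<longrightarrow> f' x < 0"
    with der show ?thesis by (rule level_eventually_one_sided)
  next
    assume "\<forall>\<^sub>F x in at_left b. f x = g \<longrightarrow> f' x > 0"
    then have "\<forall>\<^sub>F x in at_left b. - f x = - g \<longrightarrow> - f' x < 0"
      by (rule eventually_mono) auto
    from level_eventually_one_sided[of b "\<lambda>x. - f x" "\<lambda>x. - f' x" "- g", OF DERIV_minus[OF der] this]
    show ?thesis by auto
  qed
  define U where "U = {g. \<forall>\<^sub>F x in at_left b. g < f x}"
  have AU: "A \<in> U" using lo by (simp add: U_def)
  have UB: "g \<le> B" if "g \<in> U" for g
  proof -
    have "\<forall>\<^sub>F x in at_left b. g < f x \<and> f x < B"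
      using that hi unfolding U_def by (auto intro: eventually_conj)
    then have "\<exists>x. g < f x \<and> f x < B"
      by (rule eventually_happens'[rotated]) simp
    then show ?thesis by auto
  qed
  have bdd: "bdd_above U" unfolding bdd_above_def using UB by blast
  define L where "L = Sup U"
  have AL: "A \<le> L" using AU bdd by (auto simp: L_def intro: cSup_upper)
  have "(f \<longlongrightarrow> L) (at_left b)"
  proof (rule order_tendstoI)
    fix c assume "c < L"
    then obtain g where "g \<in> U" "c < g"
      unfolding L_def using less_cSup_iff[of U c] AU bdd by auto
    then show "\<forall>\<^sub>F x in at_left b. c < f x"
      unfolding U_def by (auto elim: eventually_mono)
  next
    fix c assume c: "L < c"
    have "\<exists>g. g \<in> {L<..<c} - Z"
      using infinite_imp_nonempty[OF Diff_infinite_finite[OF fin infinite_Ioo[OF c]]] by blast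
    then obtain g where g: "L < g" "g < c" "g \<notin> Z" by auto
    have "g \<notin> U" using g bdd by (auto simp: L_def dest: cSup_upper)
    then have "\<forall>\<^sub>F x in at_left b. f x < g"
      using sides[of g] AL g by (auto simp: U_def)
    then show "\<forall>\<^sub>F x in at_left b. f x < c"
      by (rule eventually_mono) (use g in auto)
  qed
  then show ?thesis by blast
qed

section \<open>The algebraic inequality on the barrier\<close>

text \<open>
  What remains of the barrier inequality after division by the positive common factors. In the
  application \<open>n = d\<close>, \<open>y = w\<^sub>2 - w\<close>, \<open>z = w\<^sub>3 - w\<close>, \<open>a = u - \<eta>\<close>, \<open>b = d (w - w\<^sub>e)\<close>,
  \<open>\<mu> = (\<sigma> + l u) / (\<sigma> + u)\<close> and \<open>X = b D / y\<close>. The ratio \<open>\<mu>\<close> lies between \<open>1\<close> and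
  \<open>(l + 1) / 2\<close>, hence the case distinction. For \<open>l \<ge> 1\<close> the term \<open>l a\<^sup>2\<close> is left as a positive
  remainder. For \<open>l < 1\<close> the contribution of \<open>b\<close> has the wrong sign, and the bound
  \<open>b \<le> l a - (l + n) y\<close> (a consequence of \<open>w\<^sub>2 < w\<^sub>5\<close>) reduces the remainder to \<open>l\<^sup>2 a\<^sup>2\<close>.
\<close>

lemma reduced_barrier_inequality:
  fixes l n a b y z \<mu> X :: real
  assumes l: "0 < l" and n: "1 < n" and y: "0 < y" and z: "0 < z" "z \<le> a"
    and b: "0 < b" "b \<le> l * a - (l + n) * y"
    and mu: "0 < \<mu>" "l \<ge> 1 \<Longrightarrow> \<mu> \<le> (l + 1) / 2" "l < 1 \<Longrightarrow> \<mu> \<le> 1"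
    and X: "X \<le> (n - 1) * z * \<mu> / (l + 1)"
  shows "y * z * \<mu>\<^sup>2 < a * l * (a + b) - b * z * \<mu> + ((l + n) * a - X) * l * y"
    and "X < (l + n) * a"
proof -
  have a: "0 < a" using z by simp
  have zmu: "z * \<mu> \<le> a * \<mu>" using z mu by simp
  have X2: "X \<le> (n - 1) * (a * \<mu>) / (l + 1)"
  proof -
    have "(n - 1) * z * \<mu> / (l + 1) \<le> (n - 1) * (a * \<mu>) / (l + 1)"
      using mult_left_mono[OF zmu, of "n - 1"] n l by (intro divide_right_mono) (auto simp: mult.assoc)
    then show ?thesis using X by linarith
  qed
  have ya: "0 < y * a" using y a by simp
  have "y * z * \<mu>\<^sup>2 < a * l * (a + b) - b * z * \<mu> + ((l + n) * a - X) * l * y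
    \<and> X < (l + n) * a"
  proof (cases "l \<ge> 1")
    case True
    have am: "a * \<mu> \<le> a * ((l + 1) / 2)" using mu(2)[OF True] a by (intro mult_left_mono) auto
    then have "(n - 1) * (a * \<mu>) / (l + 1) \<le> (n - 1) * (a * ((l + 1) / 2)) / (l + 1)"
      using n l mult_left_mono[OF am, of "n - 1"] by (intro divide_right_mono) auto
    also have "\<dots> = (n - 1) * a / 2" using l by (simp add: field_simps)
    finally have X3: "X \<le> (n - 1) * a / 2" using X2 by linarith
    have s1: "b * z * \<mu> \<le> b * a * ((l + 1) / 2)"
      using mult_left_mono[OF order_trans[OF zmu am], of b] b by (simp add: mult.assoc)
    have "\<mu>\<^sup>2 \<le> ((l + 1) / 2)\<^sup>2" using mu True by (intro power_mono) auto
    then have s2: "y * z * \<mu>\<^sup>2 \<le> y * a * ((l + 1) / 2)\<^sup>2"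
      using y z a by (intro mult_mono) auto
    have s3: "((l + n) * a - (n - 1) * a / 2) * (l * y) \<le> ((l + n) * a - X) * (l * y)"
      using X3 l y by (intro mult_right_mono) auto
    have s4: "y * a * (l * (l + (n + 1) / 2) - ((l + 1) / 2)\<^sup>2) \<ge> 0"
    proof -
      have "l * (l + 1) \<le> l * (l + (n + 1) / 2)" using l n by (intro mult_left_mono) auto
      moreover have "((l + 1) / 2)\<^sup>2 \<le> l * (l + 1)"
        using True mult_right_mono[of "l + 1" "4 * l" "l + 1"]
        by (simp add: power2_eq_square algebra_simps)
      ultimately have "0 \<le> l * (l + (n + 1) / 2) - ((l + 1) / 2)\<^sup>2" by linarith
      then show ?thesis by (rule mult_nonneg_nonneg[OF less_imp_le[OF ya]])
    qed
    have s5: "a * b * (l - (l + 1) / 2) \<ge> 0" using a b True by (intro mult_nonneg_nonneg) auto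
    have s6: "l * a\<^sup>2 > 0" using l a by simp
    have "y * z * \<mu>\<^sup>2 < a * l * (a + b) - b * z * \<mu> + ((l + n) * a - X) * l * y"
    proof -
      have "a * l * (a + b) - b * z * \<mu> + ((l + n) * a - X) * l * y - y * z * \<mu>\<^sup>2
        = l * a\<^sup>2 + a * b * (l - (l + 1) / 2) + y * a * (l * (l + (n + 1) / 2) - ((l + 1) / 2)\<^sup>2)
          + (b * a * ((l + 1) / 2) - b * z * \<mu>) + (y * a * ((l + 1) / 2)\<^sup>2 - y * z * \<mu>\<^sup>2)
          + (((l + n) * a - X) * (l * y) - ((l + n) * a - (n - 1) * a / 2) * (l * y))"
        by (simp add: field_simps power2_eq_square)
      then show ?thesis using s1 s2 s3 s4 s5 s6 by linarith
    qed
    moreover have "X < (l + n) * a"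
    proof -
      have "(n - 1) * a / 2 < (l + n) * a" using mult_strict_right_mono[of "(n - 1) / 2" "l + n" a] a l n by simp
      then show ?thesis using X3 by simp
    qed
    ultimately show ?thesis by blast
  next
    case False
    then have l1: "l < 1" by simp
    have m1: "\<mu> \<le> 1" using mu(3) l1 .
    have am: "a * \<mu> \<le> a" using m1 a by (simp add: mult_left_le)
    have "X \<le> (n - 1) * (a * \<mu>) / (l + 1)" by (fact X2)
    also have "\<dots> \<le> (n - 1) * a / (l + 1)"
      using n l mult_left_mono[OF am, of "n - 1"] by (intro divide_right_mono) auto
    also have "\<dots> \<le> (n - 1) * a / 1"
      using n l a by (intro divide_left_mono) auto
    finally have X3: "X \<le> (n - 1) * a" by simp
    have s1: "b * z * \<mu> \<le> b * a"
      using mult_left_mono[OF order_trans[OF zmu am], of b] b by (simp add: mult.assoc)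
    have "\<mu>\<^sup>2 \<le> 1" using m1 mu by (simp add: power_le_one)
    then have s2: "y * z * \<mu>\<^sup>2 \<le> y * a * 1"
      using y z a by (intro mult_mono) auto
    have s3: "((l + n) * a - (n - 1) * a) * (l * y) \<le> ((l + n) * a - X) * (l * y)"
      using X3 l y by (intro mult_right_mono) auto
    have s4: "(1 - l) * a * b \<le> (1 - l) * a * (l * a - (l + n) * y)"
      using l1 a b by (intro mult_left_mono) auto
    have s5: "y * a * ((1 - l) * (l + n) + l * (l + 1) - 1) \<ge> 0"
    proof -
      have "1 - l \<le> (1 - l) * (l + n)"
        using mult_left_mono[of 1 "l + n" "1 - l"] l l1 n by simp
      moreover have "l \<le> l * (l + 1)" using mult_left_mono[of 1 "l + 1" l] l by simp
      ultimately have "0 \<le> (1 - l) * (l + n) + l * (l + 1) - 1" by linarith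
      then show ?thesis by (rule mult_nonneg_nonneg[OF less_imp_le[OF ya]])
    qed
    have s6: "l\<^sup>2 * a\<^sup>2 > 0" using l a by simp
    have "y * z * \<mu>\<^sup>2 < a * l * (a + b) - b * z * \<mu> + ((l + n) * a - X) * l * y"
    proof -
      have "a * l * (a + b) - b * z * \<mu> + ((l + n) * a - X) * l * y - y * z * \<mu>\<^sup>2
        = l\<^sup>2 * a\<^sup>2 + ((1 - l) * a * (l * a - (l + n) * y) - (1 - l) * a * b)
          + y * a * ((1 - l) * (l + n) + l * (l + 1) - 1)
          + (b * a - b * z * \<mu>) + (y * a * 1 - y * z * \<mu>\<^sup>2)
          + (((l + n) * a - X) * (l * y) - ((l + n) * a - (n - 1) * a) * (l * y))"
        by (simp add: algebra_simps power2_eq_square)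
      then show ?thesis using s1 s2 s3 s4 s5 s6 by linarith
    qed
    moreover have "X < (l + n) * a"
    proof -
      have "(n - 1) * a < (l + n) * a" using a l by (intro mult_strict_right_mono) auto
      then show ?thesis using X3 by simp
    qed
    ultimately show ?thesis by blast
  qed
  then show "y * z * \<mu>\<^sup>2 < a * l * (a + b) - b * z * \<mu> + ((l + n) * a - X) * l * y"
    and "X < (l + n) * a" by auto
qed

text \<open>
  The hypothesis \<open>on\<close> says that the point lies on the barrier curve \<open>q Q = P D S\<close>, where
  \<open>D = s - u\<close>, \<open>S = s + u\<close> and \<open>P\<close> includes the shift by \<open>\<eta>\<close>; the conclusion is the sign of the derivative of \<open>q Q - P D S\<close> along
  the flow, \<open>W\<close> and \<open>Sg\<close> being \<open>w'\<close> and \<open>\<sigma>'\<close> there. Divided by \<open>P D S\<close>, that derivative is a sum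
  of logarithmic derivatives. Since \<open>W + Sg = - D - \<eta>\<close> on the curve, it equals \<open>- R / m\<close> with
  \<open>R = T (1/y + \<dots>) - (1 + \<eta>/D) ((l + 1) u + \<mu> D)\<close> and \<open>T = m W\<close>. The value \<open>T / y\<close> is
  \<open>(l + n) u - X + K / y\<close>: here \<open>(l + n) u\<close> beats \<open>(l + 1) u\<close>, the reduced inequality takes care of
  \<open>X\<close> and \<open>\<mu> D\<close>, and \<open>K / y\<close>, which comes from \<open>\<kappa> = w\<^sub>5 - w\<^sub>2\<close>, absorbs the terms with \<open>\<eta> / D\<close>,
  because \<open>D\<close> is of the order of \<open>y\<close> on the curve.
\<close>

lemma barrier_derivative_negative:
  fixes l n u b y z s \<eta> \<kappa> P Q W Sg :: real
  assumes l: "0 < l" and n: "1 < n" and y: "0 < y" "y \<le> z" and z: "z \<le> u - \<eta>"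
    and u: "u \<le> 1" and eta: "0 < \<eta>" and s: "u < s"
    and b: "0 < b" "l * u - b = (l + n) * (y + \<kappa>)"
    and small: "\<eta> * (l + (l + 1) + 2 * l * (l + 1)\<^sup>2 / ((n - 1) * z)) \<le> (l + n) * \<kappa>"
    and Q: "Q = u + s / l" and P: "P = u + b - \<eta>"
    and on: "(n - 1) * y * z * Q = P * ((s - u) * (s + u))"
    and W: "W = u * (P / Q) - b" and Sg: "Sg = - s + s * (P / Q) / l"
  shows "- (n - 1) * (y + z) * W * Q + (n - 1) * y * z * (- W + Sg / l)
    - (n - 1) * W * ((s - u) * (s + u)) - P * ((Sg + W) * (s + u) + (s - u) * (Sg - W)) < 0"
proof -
  define D S m a where "D = s - u" and "S = s + u" and "m = s + l * u" and "a = u - \<eta>"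
  define \<mu> X where "\<mu> = m / S" and "X = b * D / y"
  define K where "K = u * ((l + n) * \<kappa> - l * \<eta>)"
  have z0: "0 < z" using y by linarith
  have a0: "0 < a" using z z0 by (simp add: a_def)
  have u0: "0 < u" using a0 eta by (simp add: a_def)
  have lu: "0 < l * u" using l u0 by simp
  have pos: "0 < D" "0 < S" "0 < m" "D < S" "u < m"
    using s u0 lu by (simp_all add: D_def S_def m_def)
  have Qm: "Q = m / l" using l by (simp add: Q m_def field_simps)
  have Pab: "P = a + b" by (simp add: P a_def)
  have P0: "0 < P" using a0 b by (simp add: Pab)
  have mu0: "0 < \<mu>" using pos by (simp add: \<mu>_def)
  have coef: "0 \<le> 2 * l * (l + 1)\<^sup>2 / ((n - 1) * z)" using l n z0 by simp
  have small1: "\<eta> * l + \<eta> * (l + 1) + \<eta> * (2 * l * (l + 1)\<^sup>2 / ((n - 1) * z)) \<le> (l + n) * \<kappa>"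
    using small by (simp only: distrib_left)
  have e1: "0 \<le> \<eta> * (l + 1)" using eta l by simp
  have e2: "0 \<le> \<eta> * (2 * l * (l + 1)\<^sup>2 / ((n - 1) * z))" using mult_nonneg_nonneg[OF less_imp_le[OF eta] coef] .
  have kap: "\<eta> * l \<le> (l + n) * \<kappa>" using small1 e1 e2 by linarith
  have bl: "b \<le> l * a - (l + n) * y"
    using b(2) kap by (simp add: a_def algebra_simps)
  have bla: "b \<le> l * a" using bl mult_pos_pos[of "l + n" y] l n y by linarith
  \<comment> \<open>On the barrier \<open>D\<close> obeys a linear equation.\<close>
  have sum: "Sg + W = - D - \<eta>"
  proof -
    have "0 < Q" using Qm pos l by simp
    then have "P / Q * Q = P" by simp
    then have "P / Q * u + P / Q * (s / l) = P" by (simp only: Q distrib_left)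
    moreover have "Sg + W = - s + (P / Q * u + P / Q * (s / l)) - b" by (simp add: W Sg mult.commute)
    ultimately show ?thesis by (simp add: D_def P)
  qed
  have DX: "D = (n - 1) * y * z * m / (l * P * S)"
    using on pos P0 l by (simp add: Qm D_def[symmetric] S_def[symmetric] field_simps)
  have Xeq: "X = (n - 1) * z * \<mu> * (b / (l * P))"
    using y by (simp add: X_def DX \<mu>_def mult_ac)
  have bP: "b / (l * P) \<le> 1 / (l + 1)"
  proof -
    have "b * (l + 1) \<le> l * P" using bla by (simp add: Pab algebra_simps)
    then show ?thesis using l P0 by (simp add: pos_le_divide_eq pos_divide_le_eq)
  qed
  have Xle: "X \<le> (n - 1) * z * \<mu> / (l + 1)"
    using mult_left_mono[OF bP, of "(n - 1) * z * \<mu>"] n z0 mu0 by (simp add: Xeq)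
  have mu1: "\<mu> \<le> (l + 1) / 2" if "l \<ge> 1"
  proof -
    have "0 \<le> (l - 1) * D" using that pos by simp
    then have "2 * m \<le> (l + 1) * S" by (simp add: m_def S_def D_def algebra_simps)
    then show ?thesis using pos by (simp add: \<mu>_def field_simps)
  qed
  have mu2: "\<mu> \<le> 1" if "l < 1"
    using that u0 pos by (simp add: \<mu>_def m_def S_def)
  have mu3: "\<mu> \<le> l + 1" using mu1 mu2 l by fastforce
  have mu4: "1 / \<mu> \<le> 2"
  proof -
    have "S \<le> 2 * m" using lu s by (simp add: m_def S_def)
    then show ?thesis using pos by (simp add: \<mu>_def field_simps)
  qed
  note core = reduced_barrier_inequality[OF l n y(1) z0 _ b(1) bl mu0 mu1 mu2 Xle]
  have za: "z \<le> a" using z by (simp add: a_def)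
  \<comment> \<open>The reduced inequality, with the curve equation used to eliminate \<open>D\<close>.\<close>
  have c1: "\<mu> * D < (n - 1) * a - X + ((l + n) * a - X) * y * ((n - 1) / P)"
  proof -
    have "(n - 1) / (l * P) * (y * z * \<mu>\<^sup>2)
      < (n - 1) / (l * P) * (a * l * (a + b) - b * z * \<mu> + ((l + n) * a - X) * l * y)"
      using core(1)[OF za] n l P0 by (intro mult_strict_left_mono) auto
    moreover have "(n - 1) / (l * P) * (y * z * \<mu>\<^sup>2) = \<mu> * D"
      using pos by (simp add: DX \<mu>_def power2_eq_square field_simps)
    moreover have "(n - 1) / (l * P) * (a * l * (a + b) - b * z * \<mu> + ((l + n) * a - X) * l * y)
      = (n - 1) * a - X + ((l + n) * a - X) * y * ((n - 1) / P)"
    proof -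
      have "(n - 1) / (l * P) * (a * l * (a + b)) = (n - 1) * a"
        using l P0 by (simp add: Pab[symmetric])
      moreover have "(n - 1) / (l * P) * (b * z * \<mu>) = X" by (simp add: Xeq)
      moreover have "(n - 1) / (l * P) * (((l + n) * a - X) * l * y) = ((l + n) * a - X) * y * ((n - 1) / P)"
        using l by simp
      ultimately show ?thesis by (simp only: distrib_left right_diff_distrib)
    qed
    ultimately show ?thesis by simp
  qed
  define T where "T = W * m"
  have T: "T = ((l + n) * u - X) * y + K"
  proof -
    have "T = l * u * P - b * m" using pos l by (simp add: T_def W Qm field_simps)
    also have "\<dots> = u * (l * u - b) - b * D - l * u * \<eta>"
      by (simp add: P m_def D_def algebra_simps)
    also have "\<dots> = ((l + n) * u - b * D / y) * y + K"
      using y unfolding b(2) K_def by (simp add: field_simps)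
    finally show ?thesis by (simp add: X_def)
  qed
  have K0: "0 \<le> K" using u0 kap by (simp add: K_def mult.commute)
  have T0: "((l + n) * a - X) * y \<le> T" "0 < ((l + n) * a - X) * y"
  proof -
    have "(l + n) * a \<le> (l + n) * u" using eta l n by (simp add: a_def)
    then have "((l + n) * a - X) * y \<le> ((l + n) * u - X) * y" using y by (intro mult_right_mono) auto
    then show "((l + n) * a - X) * y \<le> T" using K0 by (simp add: T)
    show "0 < ((l + n) * a - X) * y" using core(2)[OF za] y by simp
  qed
  \<comment> \<open>The price of the shift \<open>\<eta>\<close>.\<close>
  have c2: "\<eta> * \<mu> + \<eta> * (l + 1) * u / D \<le> K / y"
  proof -
    have yD: "y / D = l * P / ((n - 1) * z) * (1 / \<mu>)"
      using pos y l n z0 P0 by (simp add: DX \<mu>_def)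
    have Pl: "P \<le> l + 1"
    proof -
      have "P \<le> (l + 1) * a" using bla by (simp add: Pab algebra_simps)
      also have "\<dots> \<le> (l + 1) * 1" using u eta l by (intro mult_left_mono) (auto simp: a_def)
      finally show ?thesis by simp
    qed
    have "l * P / ((n - 1) * z) * (1 / \<mu>) \<le> l * (l + 1) / ((n - 1) * z) * 2"
      using Pl l n z0 P0 mu4 mu0 by (intro mult_mono divide_right_mono mult_left_mono) auto
    then have yD2: "y / D \<le> 2 * l * (l + 1) / ((n - 1) * z)" by (simp add: yD mult_ac)
    have "\<eta> * (l + 1) * (y / D) \<le> \<eta> * (l + 1) * (2 * l * (l + 1) / ((n - 1) * z))"
      using yD2 eta l by (intro mult_left_mono) auto
    also have "\<dots> = \<eta> * (2 * l * (l + 1)\<^sup>2 / ((n - 1) * z))" by (simp add: power2_eq_square)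
    finally have t1: "\<eta> * (l + 1) * (y / D) \<le> \<eta> * (2 * l * (l + 1)\<^sup>2 / ((n - 1) * z))" .
    have "u * (\<eta> * (l + 1) * (y / D)) \<le> u * ((l + n) * \<kappa> - l * \<eta> - \<eta> * (l + 1))"
      using t1 small1 u0 by (intro mult_left_mono) (auto simp: mult.commute)
    moreover have "\<eta> * \<mu> * y \<le> \<eta> * (l + 1) * u"
      using mu3 eta y z l mu0 by (intro mult_mono) auto
    ultimately have "\<eta> * \<mu> * y + \<eta> * (l + 1) * u * (y / D) \<le> K"
      by (simp add: K_def algebra_simps)
    then show ?thesis using y by (simp add: field_simps)
  qed
  have c3: "0 \<le> 1 / z + (l - 1) * D / (m * S)"
  proof -
    have "1 / m \<le> 1 / z" using pos z z0 eta by (intro divide_left_mono) auto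
    moreover have "- (1 / m) \<le> (l - 1) * D / (m * S)"
    proof -
      have "0 \<le> l * D" using l pos by simp
      then have "- S \<le> (l - 1) * D" using pos by (simp add: algebra_simps)
      then have "(- S) / (m * S) \<le> (l - 1) * D / (m * S)" using pos by (intro divide_right_mono) auto
      then show ?thesis using pos by simp
    qed
    ultimately show ?thesis by linarith
  qed
  define R where "R = T * ((n - 1) / P + 1 / y + (1 / z + (l - 1) * D / (m * S)))
    - (1 + \<eta> / D) * ((l + 1) * u + \<mu> * D)"
  have R0: "0 < R"
  proof -
    have r1: "((l + n) * a - X) * y * ((n - 1) / P) \<le> T * ((n - 1) / P)"
      using T0 n P0 by (intro mult_right_mono) auto
    have r2: "T * (1 / y) = (l + n) * u - X + K / y" using y by (simp add: T field_simps)
    have r3: "0 \<le> T * (1 / z + (l - 1) * D / (m * S))" using T0 c3 by (intro mult_nonneg_nonneg) auto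
    have r4: "(1 + \<eta> / D) * ((l + 1) * u + \<mu> * D)
      = (l + 1) * u + \<mu> * D + (\<eta> * \<mu> + \<eta> * (l + 1) * u / D)"
      using pos by (simp add: field_simps)
    have r5: "(n - 1) * a \<le> (n - 1) * u" using n eta by (simp add: a_def)
    have r6: "(l + n) * u = (l + 1) * u + (n - 1) * u" by (simp add: algebra_simps)
    have "R = T * ((n - 1) / P) + T * (1 / y) + T * (1 / z + (l - 1) * D / (m * S))
      - (1 + \<eta> / D) * ((l + 1) * u + \<mu> * D)"
      unfolding R_def by (simp only: distrib_left)
    then show ?thesis unfolding r2 r4 using r1 r3 r5 r6 c1 c2 by linarith
  qed
  have on': "(n - 1) * y * z * (m / l) = P * D * S"
    using on by (simp add: Qm D_def S_def)
  have Sg': "Sg = - D - \<eta> - W" using sum by simp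
  have t1: "(n - 1) * (y + z) * W * Q = P * D * S * (W * (1 / y + 1 / z))"
  proof -
    have yz: "y * z * (1 / y + 1 / z) = y + z" using y z0 by (simp add: field_simps)
    have "(n - 1) * y * z * (m / l) * (W * (1 / y + 1 / z))
      = (n - 1) * (y * z * (1 / y + 1 / z)) * W * (m / l)"
      by (simp only: mult_ac)
    then show ?thesis unfolding on' yz Qm by simp
  qed
  have t2: "(n - 1) * y * z * (- W + Sg / l) = P * D * S * ((- l * W + Sg) / m)"
    unfolding on'[symmetric] using pos l by (simp add: field_simps)
  have t3: "(n - 1) * W * (D * S) = P * D * S * (W * (n - 1) / P)"
    using P0 by simp
  have t4: "P * ((Sg + W) * S + D * (Sg - W)) = P * D * S * ((- D - \<eta>) / D + (- D - \<eta> - 2 * W) / S)"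
    unfolding sum unfolding Sg' using pos by (simp add: field_simps)
  \<comment> \<open>The sum of the logarithmic derivatives.\<close>
  have R': "- (W * (1 / y + 1 / z)) + (- l * W + Sg) / m - W * (n - 1) / P
    - ((- D - \<eta>) / D + (- D - \<eta> - 2 * W) / S) = - R / m"
  proof -
    have g1: "(- l * W + Sg) / m + 2 * W / S = - (W * ((l - 1) * D / (m * S))) + (- D - \<eta>) / m"
    proof -
      have "(- l * W + Sg) * S + 2 * W * m = - (W * ((l - 1) * D)) + (- D - \<eta>) * S"
        unfolding Sg' by (simp add: m_def S_def D_def algebra_simps)
      then show ?thesis using pos by (simp add: divide_simps)
    qed
    have g2: "(1 + \<eta> / D) * ((l + 1) * u + \<mu> * D) / m
      = (- D - \<eta>) / m - ((- D - \<eta>) / D + (- D - \<eta>) / S)"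
    proof -
      have mD: "(l + 1) * u = m - D" by (simp add: m_def D_def algebra_simps)
      show ?thesis unfolding mD \<mu>_def using pos by (simp add: field_simps)
    qed
    have g3: "R / m = W * ((n - 1) / P + 1 / y + (1 / z + (l - 1) * D / (m * S)))
      - (1 + \<eta> / D) * ((l + 1) * u + \<mu> * D) / m"
      unfolding R_def T_def using pos by (simp add: diff_divide_distrib)
    have g4: "(- D - \<eta> - 2 * W) / S = (- D - \<eta>) / S - 2 * W / S"
      by (simp add: diff_divide_distrib)
    show ?thesis using g1 g2 g3 g4 by (simp add: algebra_simps)
  qed
  have factor: "- (E * w1) + E * w2 - E * w3 - E * w4 = E * (- w1 + w2 - w3 - w4)"
    for E w1 w2 w3 w4 :: real by (simp add: algebra_simps)
  have "- (n - 1) * (y + z) * W * Q + (n - 1) * y * z * (- W + Sg / l)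
    - (n - 1) * W * ((s - u) * (s + u)) - P * ((Sg + W) * (s + u) + (s - u) * (Sg - W))
    = - ((n - 1) * (y + z) * W * Q) + (n - 1) * y * z * (- W + Sg / l)
    - (n - 1) * W * (D * S) - P * ((Sg + W) * S + D * (Sg - W))"
    by (simp only: D_def S_def minus_mult_left minus_diff_eq)
  also have "\<dots> = P * D * S * (- R / m)" unfolding t1 t2 t3 t4 factor R' ..
  also have "\<dots> < 0" using P0 pos R0 by (simp add: mult_pos_neg)
  finally show ?thesis .
qed

section \<open>The sonic points\<close>

definition sonic_quadratic :: "nat \<Rightarrow> real \<Rightarrow> real \<Rightarrow> real \<Rightarrow> real" where
  "sonic_quadratic d l r w =
     (real d - 1) * w\<^sup>2 - (real d - l + l * r - r) * w + l * (r - 1)"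

definition w3 :: "nat \<Rightarrow> real \<Rightarrow> real \<Rightarrow> real" where
  "w3 d l r = (real d - 1 + (l - 1) * (r - 1) + sqrt (J d l r)) / (2 * (real d - 1))"

text \<open>
  The \<open>w\<close>-coordinate of the point at which \<open>\<Delta>\<^sub>1 = \<Delta>\<^sub>2 = 0\<close> with \<open>\<sigma> > 0\<close>, other than the sonic points:
  eliminating \<open>\<sigma>\<^sup>2\<close> leaves a cubic equation for \<open>w\<close>, of which the sonic quadratic is a factor.
\<close>

definition w5 :: "nat \<Rightarrow> real \<Rightarrow> real \<Rightarrow> real" where
  "w5 d l r = l * r / (real d + l)"

text \<open>
  The common consequences of the two parameter ranges: the discriminant \<open>J\<close> is positive, so that
  \<open>P\<^sub>2\<close> is not a double root, and the stationary point lies to the right of \<open>P\<^sub>2\<close>.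
\<close>

locale subcritical =
  fixes d :: nat and l r :: real
  assumes d2: "d \<ge> 2" and l_pos: "0 < l" and r_gt: "1 < r"
    and below_r_plus: "(r - 1) * (1 + sqrt l)\<^sup>2 < real d - 1"
    and w2_less_w5: "w2 d l r < w5 d l r"
begin

abbreviation "n \<equiv> real d"
abbreviation "q \<equiv> sonic_quadratic d l r"

lemma n_gt: "1 < n" using d2 by simp

lemma r_bound: "(r - 1) * (1 + l) < n - 1"
proof -
  have "(r - 1) * (1 + l) \<le> (r - 1) * (1 + sqrt l)\<^sup>2"
    using r_gt l_pos by (intro mult_left_mono) (auto simp: power2_eq_square algebra_simps)
  then show ?thesis using below_r_plus by linarith
qed

end

lemma below_r_plusD:
  assumes "0 < l" "r < r_plus d l"
  shows "(r - 1) * (1 + sqrt l)\<^sup>2 < real d - 1"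
proof -
  have "0 < (1 + sqrt l)\<^sup>2"
    using real_sqrt_gt_zero[OF assms(1)] by (intro zero_less_power add_pos_pos) simp_all
  moreover have "r - 1 < (real d - 1) / (1 + sqrt l)\<^sup>2" using assms by (simp add: r_plus_def)
  ultimately show ?thesis by (simp add: pos_less_divide_eq)
qed

lemma J_factor:
  assumes "0 \<le> l"
  shows "J d l r = (real d - 1 - (r - 1) * (1 - sqrt l)\<^sup>2) * (real d - 1 - (r - 1) * (1 + sqrt l)\<^sup>2)"
proof -
  define t where "t = sqrt l"
  have l: "l = t\<^sup>2" using assms by (simp add: t_def)
  show ?thesis
    unfolding J_def t_def[symmetric] unfolding l by (simp add: power2_eq_square algebra_simps)
qed

lemma J_positive:
  assumes "0 < l" "1 < r" "(r - 1) * (1 + sqrt l)\<^sup>2 < real d - 1"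
  shows "0 < J d l r"
proof -
  have "(1 - sqrt l)\<^sup>2 \<le> (1 + sqrt l)\<^sup>2" using assms by (simp add: power2_eq_square algebra_simps)
  then have "(r - 1) * (1 - sqrt l)\<^sup>2 \<le> (r - 1) * (1 + sqrt l)\<^sup>2"
    using assms by (intro mult_left_mono) auto
  then have "(r - 1) * (1 - sqrt l)\<^sup>2 < real d - 1" using assms(3) by linarith
  then show ?thesis using assms by (simp add: J_factor)
qed

lemma sonic_quadratic_factor:
  assumes "d \<ge> 2" "0 \<le> J d l r"
  shows "sonic_quadratic d l r w = (real d - 1) * (w2 d l r - w) * (w3 d l r - w)"
proof -
  define k b s where "k = real d - 1" and "b = real d - 1 + (l - 1) * (r - 1)" and "s = sqrt (J d l r)"
  have k: "k > 0" using assms by (simp add: k_def)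
  have "s\<^sup>2 = J d l r" using assms by (simp add: s_def)
  also have "\<dots> = b\<^sup>2 - 4 * k * (l * (r - 1))"
    by (simp add: J_def b_def k_def power2_eq_square algebra_simps)
  finally have s: "b\<^sup>2 - s\<^sup>2 = 4 * k * (l * (r - 1))" by simp
  have "k * (w2 d l r - w) * (w3 d l r - w)
    = k * w\<^sup>2 - b * w + (b\<^sup>2 - s\<^sup>2) / (4 * k)"
  proof -
    have e: "w2 d l r = (b - s) / (2 * k)" "w3 d l r = (b + s) / (2 * k)"
      by (simp_all add: w2_def w3_def b_def s_def k_def)
    show ?thesis unfolding e using k by (simp add: field_simps power2_eq_square)
  qed
  also have "\<dots> = k * w\<^sup>2 - b * w + l * (r - 1)" using k unfolding s by simp
  also have "\<dots> = sonic_quadratic d l r w"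
    by (simp add: sonic_quadratic_def k_def b_def algebra_simps)
  finally show ?thesis by (simp add: k_def)
qed

text \<open>The first bracket on the right changes sign exactly at \<open>r = r\<^sup>*\<close>.\<close>

lemma sonic_quadratic_at_w5:
  assumes "0 < l" "0 < d"
  shows "l * sonic_quadratic d l r (w5 d l r) * (real d + l)\<^sup>2
    = l\<^sup>2 * ((sqrt (real d) + l) * r - (real d + l)) * ((real d + l) + (sqrt (real d) - l) * r)"
proof -
  have n: "real d = (sqrt (real d))\<^sup>2" by simp
  have *: "w5 d l r * (real d + l) = l * r" using assms by (simp add: w5_def)
  have "l * sonic_quadratic d l r (w5 d l r) * (real d + l)\<^sup>2
    = l * ((real d - 1) * (w5 d l r * (real d + l))\<^sup>2
      - (real d - l + l * r - r) * (w5 d l r * (real d + l)) * (real d + l) + l * (r - 1) * (real d + l)\<^sup>2)"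
    by (simp add: sonic_quadratic_def power2_eq_square algebra_simps)
  also have "\<dots> = l\<^sup>2 * (real d * r\<^sup>2 - (real d + l - l * r)\<^sup>2)"
    unfolding * by (simp add: power2_eq_square algebra_simps)
  also have "\<dots> = l\<^sup>2 * ((sqrt (real d) + l) * r - (real d + l)) * ((real d + l) + (sqrt (real d) - l) * r)"
    by (subst n) (simp add: power2_eq_square algebra_simps)
  finally show ?thesis .
qed

text \<open>With \<open>k = \<surd>d\<close> and \<open>t = \<surd>l\<close> the difference is a nonnegative multiple of \<open>(t - k)\<^sup>2\<close>.\<close>

lemma r_star_le_r_plus:
  assumes "0 < l" "0 < d"
  shows "r_star d l \<le> r_plus d l"
proof -
  define k t where "k = sqrt (real d)" and "t = sqrt l"
  have k: "0 < k" "real d = k\<^sup>2" and t: "0 < t" "l = t\<^sup>2" using assms by (auto simp: k_def t_def)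
  have k1: "1 \<le> k" using assms by (simp add: k_def)
  have pos: "0 < t\<^sup>2 + k" using k t by (simp add: add_pos_pos)
  have "k * (1 + t)\<^sup>2 \<le> (k + 1) * (t\<^sup>2 + k)"
  proof -
    have "(k + 1) * (t\<^sup>2 + k) - k * (1 + t)\<^sup>2 = (t - k)\<^sup>2"
      by (simp add: power2_eq_square algebra_simps)
    then show ?thesis using zero_le_power2[of "t - k"] by linarith
  qed
  then have "(k - 1) * (k * (1 + t)\<^sup>2) \<le> (k - 1) * ((k + 1) * (t\<^sup>2 + k))"
    using k1 by (intro mult_left_mono) auto
  then have "(k\<^sup>2 - k) * (1 + t)\<^sup>2 \<le> (k\<^sup>2 - 1) * (t\<^sup>2 + k)"
    by (simp add: power2_eq_square algebra_simps)
  then have "(k\<^sup>2 - k) / (t\<^sup>2 + k) \<le> (k\<^sup>2 - 1) / (1 + t)\<^sup>2"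
    using pos t by (simp add: pos_le_divide_eq pos_divide_le_eq add_pos_pos)
  moreover have "r_star d l = 1 + (k\<^sup>2 - k) / (t\<^sup>2 + k)"
    using pos unfolding r_star_def k_def[symmetric] unfolding k(2) t(2) by (simp add: field_simps)
  moreover have "r_plus d l = 1 + (k\<^sup>2 - 1) / (1 + t)\<^sup>2"
    unfolding r_plus_def t_def[symmetric] k(2) ..
  ultimately show ?thesis by simp
qed

lemma subcritical_if_below_r_star:
  assumes d: "d \<ge> 2" and l: "0 < l" "l < real d" and r: "1 < r" "r < r_star d l"
  shows "subcritical d l r"
proof -
  have rp: "r < r_plus d l" using r r_star_le_r_plus[of l d] d l by simp
  then have bp: "(r - 1) * (1 + sqrt l)\<^sup>2 < real d - 1"
    using l rp by (intro below_r_plusD) auto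
  have J: "0 \<le> J d l r" using J_positive[OF l(1) r(1) bp] by simp
  define k where "k = sqrt (real d)"
  have k: "0 < k" "real d = k\<^sup>2" using d by (auto simp: k_def)
  have r': "(k + l) * r < real d + l"
    using r k l unfolding r_star_def k_def[symmetric] by (simp add: pos_less_divide_eq add_pos_pos mult.commute add.commute)
  have pos: "0 < (real d + l) + (k - l) * r"
  proof (cases "l \<le> k")
    case True
    then have "0 \<le> (k - l) * r" using r by simp
    then show ?thesis using l by linarith
  next
    case False
    have "0 < 2 * k * r" using k r by simp
    then show ?thesis using r' by (simp add: algebra_simps)
  qed
  have "l\<^sup>2 * ((k + l) * r - (real d + l)) * ((real d + l) + (k - l) * r) < 0"
    using l pos r' by (simp add: mult_less_0_iff zero_less_mult_iff)
  then have "l * sonic_quadratic d l r (w5 d l r) * (real d + l)\<^sup>2 < 0"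
    using sonic_quadratic_at_w5[of l d r] l d by (simp add: k_def)
  then have "sonic_quadratic d l r (w5 d l r) < 0"
    using l by (meson linorder_not_less mult_nonneg_nonneg less_imp_le zero_le_power2)
  then have "(w2 d l r - w5 d l r) * (w3 d l r - w5 d l r) < 0"
    using sonic_quadratic_factor[OF d J, of "w5 d l r"] d by (simp add: mult.assoc mult_less_0_iff)
  moreover have "w2 d l r \<le> w3 d l r" using J d by (simp add: w2_def w3_def divide_right_mono)
  ultimately have "w2 d l r < w5 d l r"
    using mult_nonneg_nonneg[of "w2 d l r - w5 d l r" "w3 d l r - w5 d l r"] by linarith
  then show ?thesis using d l r bp by unfold_locales auto
qed

text \<open>
  Here \<open>q(w\<^sub>5)\<close> may have either sign; instead, \<open>w\<^sub>5\<close> exceeds the midpoint of \<open>w\<^sub>2\<close> and \<open>w\<^sub>3\<close>, the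
  difference having the sign of \<open>(l - d) (d - 1 - (r - 1) (l + 1))\<close>.
\<close>

lemma subcritical_if_below_r_plus:
  assumes d: "d \<ge> 2" and l: "real d < l" and r: "1 < r" "r < r_plus d l"
  shows "subcritical d l r"
proof -
  have l0: "0 < l" by (rule le_less_trans[OF of_nat_0_le_iff l])
  have bp: "(r - 1) * (1 + sqrt l)\<^sup>2 < real d - 1"
    using r l0 by (intro below_r_plusD) auto
  have J: "0 < J d l r" using J_positive[OF l0 r(1) bp] .
  have "(r - 1) * (1 + l) \<le> (r - 1) * (1 + sqrt l)\<^sup>2"
    using r l0 by (intro mult_left_mono) (auto simp: power2_eq_square algebra_simps)
  then have t: "(r - 1) * (1 + l) < real d - 1" using bp by linarith
  then have "(l - real d) * ((r - 1) * (1 + l)) < (l - real d) * (real d - 1)"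
    using l by (intro mult_strict_left_mono) auto
  then have "(real d - 1 + (l - 1) * (r - 1)) * (real d + l) < 2 * (real d - 1) * (l * r)"
    by (simp add: algebra_simps)
  then have "(real d - 1 + (l - 1) * (r - 1)) / (2 * (real d - 1)) < w5 d l r"
    using d l0 by (simp add: w5_def divide_less_eq pos_less_divide_eq add_pos_pos mult_ac)
  moreover have "w2 d l r \<le> (real d - 1 + (l - 1) * (r - 1)) / (2 * (real d - 1))"
    using J d by (simp add: w2_def divide_right_mono)
  ultimately have "w2 d l r < w5 d l r" by linarith
  then show ?thesis using d l0 r bp by unfold_locales auto
qed

context subcritical
begin

lemma J_pos: "0 < J d l r" using J_positive[OF l_pos r_gt below_r_plus] .

lemma q_factor: "q w = (n - 1) * (w2 d l r - w) * (w3 d l r - w)"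
  using sonic_quadratic_factor[OF d2] J_pos by simp

lemma w2_less_w3: "w2 d l r < w3 d l r"
  using J_pos n_gt by (simp add: w2_def w3_def divide_strict_right_mono)

lemma w2_pos: "0 < w2 d l r"
proof -
  have "(1 - l) * (r - 1) \<le> (1 + l) * (r - 1)" using r_gt l_pos by (intro mult_right_mono) auto
  then have "0 < n - 1 + (l - 1) * (r - 1)" using r_bound by (simp add: algebra_simps)
  then have "0 < w3 d l r" using J_pos n_gt by (simp add: w3_def add_pos_pos)
  moreover have "0 < (n - 1) * w2 d l r * w3 d l r"
  proof -
    have "0 < q 0" using l_pos r_gt by (simp add: sonic_quadratic_def)
    then show ?thesis by (simp add: q_factor)
  qed
  ultimately show ?thesis using n_gt by (simp add: zero_less_mult_iff)
qed

lemma w3_less_1: "w3 d l r < 1"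
proof -
  have "0 < (w2 d l r - 1) * (w3 d l r - 1)"
  proof -
    have "q 1 = r - 1" by (simp add: sonic_quadratic_def algebra_simps)
    then have "0 < (n - 1) * ((w2 d l r - 1) * (w3 d l r - 1))"
      using r_gt by (simp add: q_factor mult.assoc)
    then show ?thesis using n_gt by (simp add: zero_less_mult_iff)
  qed
  moreover have "w2 d l r + w3 d l r < 2"
  proof -
    have "(l - 1) * (r - 1) \<le> (1 + l) * (r - 1)" using r_gt by (intro mult_right_mono) auto
    then have "(l - 1) * (r - 1) < n - 1" using r_bound by (simp add: mult.commute)
    moreover have "w2 d l r + w3 d l r = (n - 1 + (l - 1) * (r - 1)) / (n - 1)"
    proof -
      have half: "(a - s) / (2 * k) + (a + s) / (2 * k) = a / k" if "k > 0" for a s k :: real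
        using that by (simp add: field_simps)
      show ?thesis unfolding w2_def w3_def by (rule half) (use n_gt in simp)
    qed
    ultimately show ?thesis using n_gt by (simp add: divide_less_eq)
  qed
  ultimately show ?thesis using w2_less_w3 by (auto simp: zero_less_mult_iff)
qed

lemma q_pos: "w < w2 d l r \<Longrightarrow> 0 < q w"
  using w2_less_w3 n_gt by (simp add: q_factor)

lemma n_w_e: "n * w_e d l r = l * (r - 1)"
  using n_gt by (simp add: w_e_def)

lemma q_eq: "q w = (1 - w) * (w - n * (w - w_e d l r)) + w * (r - 1)"
proof -
  have e: "n * (w - w_e d l r) = n * w - l * (r - 1)"
    by (simp only: right_diff_distrib n_w_e)
  show ?thesis
    unfolding e by (simp add: sonic_quadratic_def algebra_simps power2_eq_square)
qed

lemma w_e_pos: "0 < w_e d l r" using l_pos r_gt n_gt by (simp add: w_e_def)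

lemma w_e_less_w2: "w_e d l r < w2 d l r"
proof (rule ccontr)
  assume *: "\<not> w_e d l r < w2 d l r"
  have "n * (w2 d l r - w_e d l r) \<le> 0" using * n_gt by (simp add: mult_nonneg_nonpos)
  then have "0 < (1 - w2 d l r) * (w2 d l r - n * (w2 d l r - w_e d l r))"
    using w2_pos w2_less_w3 w3_less_1 by (intro mult_pos_pos) auto
  moreover have "0 < w2 d l r * (r - 1)" using w2_pos r_gt by simp
  moreover have "q (w2 d l r) = 0" by (simp add: q_factor)
  ultimately show False using q_eq[of "w2 d l r"] by linarith
qed

end

section \<open>The barrier along the trajectory\<close>

context subcritical
begin

lemma sigma2_pos: "0 < sigma2 d l r"
  using w2_less_w3 w3_less_1 by (simp add: sigma2_def)

lemma Delta1_eq:
  "Delta1 d l r s w = (1 - w) * q w - n * (w - w_e d l r) * (s\<^sup>2 - (1 - w)\<^sup>2)"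
  unfolding Delta1_def q_eq by (simp add: power2_eq_square algebra_simps)

lemma Delta2_eq: "Delta2 d l r s w = s / l * (q w - l * (s\<^sup>2 - (1 - w)\<^sup>2))"
proof -
  have "(l + n - 1) * w\<^sup>2 - (l + n + l * r - r) * w + l * r - l * s\<^sup>2
    = q w - l * (s\<^sup>2 - (1 - w)\<^sup>2)"
    by (simp add: sonic_quadratic_def power2_eq_square algebra_simps)
  then show ?thesis by (simp only: Delta2_def)
qed

text \<open>
  The constraints on the margin \<open>\<eta>\<close> with which the barrier can be shifted: it must stay below
  \<open>1 - w\<^sub>3\<close>, so that \<open>w\<^sub>3 - w \<le> u - \<eta>\<close>, and it must be small against the distance
  \<open>w\<^sub>5 - w\<^sub>2\<close>, which is what pays for the shift next to \<open>P\<^sub>2\<close>.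
\<close>

definition barrier_gap :: real where
  "barrier_gap = min (1 - w3 d l r)
     ((l + n) * (w5 d l r - w2 d l r)
       / (l + (l + 1) + 2 * l * (l + 1)\<^sup>2 / ((n - 1) * (w3 d l r - w2 d l r))))"

lemma barrier_gap:
  "0 < barrier_gap" "barrier_gap \<le> 1 - w3 d l r"
  "barrier_gap * (l + (l + 1) + 2 * l * (l + 1)\<^sup>2 / ((n - 1) * (w3 d l r - w2 d l r)))
    \<le> (l + n) * (w5 d l r - w2 d l r)"
proof -
  define C K where "C = l + (l + 1) + 2 * l * (l + 1)\<^sup>2 / ((n - 1) * (w3 d l r - w2 d l r))"
    and "K = (l + n) * (w5 d l r - w2 d l r)"
  have C: "0 < C" using l_pos n_gt w2_less_w3 by (simp add: C_def add_pos_nonneg)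
  have K: "0 < K" using l_pos n_gt w2_less_w5 by (simp add: K_def)
  have e: "barrier_gap = min (1 - w3 d l r) (K / C)" by (simp add: barrier_gap_def C_def K_def)
  show "0 < barrier_gap" "barrier_gap \<le> 1 - w3 d l r" using C K w3_less_1 by (auto simp: e)
  have "barrier_gap * C \<le> K / C * C" using C by (intro mult_right_mono) (auto simp: e)
  then have "barrier_gap * C \<le> K" using C by simp
  then show "barrier_gap * (l + (l + 1) + 2 * l * (l + 1)\<^sup>2 / ((n - 1) * (w3 d l r - w2 d l r)))
    \<le> (l + n) * (w5 d l r - w2 d l r)"
    unfolding C_def K_def .
qed

lemma barrier_gap_small:
  assumes "w < w2 d l r"
  shows "barrier_gap * (l + (l + 1) + 2 * l * (l + 1)\<^sup>2 / ((n - 1) * (w3 d l r - w)))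
    \<le> (l + n) * (w5 d l r - w2 d l r)"
proof -
  have "2 * l * (l + 1)\<^sup>2 / ((n - 1) * (w3 d l r - w))
    \<le> 2 * l * (l + 1)\<^sup>2 / ((n - 1) * (w3 d l r - w2 d l r))"
    using assms l_pos n_gt w2_less_w3 by (intro divide_left_mono mult_left_mono) auto
  then have "barrier_gap * (l + (l + 1) + 2 * l * (l + 1)\<^sup>2 / ((n - 1) * (w3 d l r - w)))
    \<le> barrier_gap * (l + (l + 1) + 2 * l * (l + 1)\<^sup>2 / ((n - 1) * (w3 d l r - w2 d l r)))"
    using barrier_gap(1) by (intro mult_left_mono) auto
  then show ?thesis using barrier_gap(3) by linarith
qed

end

text \<open>
  All three inequalities follow from the single bound \<open>A - F \<ge> \<eta>\<close>: the first because
  \<open>A + F \<ge> A - F\<close>, the second because \<open>(1 - w) F / s \<le> F\<close>. The bounds on \<open>w\<close> and \<open>F\<close> are weak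
  inequalities so that the lemma also serves at \<open>P\<^sub>2\<close>, where \<open>1 - w = s\<close>.
\<close>

lemma repulsiveI:
  assumes "0 < \<eta>" "0 \<le> 1 - w" "1 - w \<le> s" "0 < s"
    and F: "0 \<le> s + s'" and gap: "\<eta> \<le> (1 - w - w') - (s + s')"
  shows "repulsive (min \<eta> (\<eta>\<^sup>2)) s w s' w'"
proof -
  define F A where "F = s + s'" and "A = 1 - w - w'"
  have AF: "\<eta> \<le> A - F" "0 \<le> F" using F gap by (simp_all add: A_def F_def)
  have "\<eta> * \<eta> \<le> (A - F) * (A + F)" using AF assms by (intro mult_mono) auto
  then have "\<eta>\<^sup>2 \<le> A\<^sup>2 - F\<^sup>2" by (simp add: power2_eq_square algebra_simps)
  moreover have "(1 - w) * F / s \<le> F"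
  proof -
    have "(1 - w) * F \<le> s * F" using assms AF by (intro mult_right_mono) auto
    then show ?thesis using assms by (simp add: pos_divide_le_eq mult.commute)
  qed
  ultimately show ?thesis using AF
    by (simp add: repulsive_def Let_def F_def[symmetric] A_def[symmetric] min_le_iff_disj)
qed

locale trajectory = subcritical +
  fixes x2 :: real and \<sigma> w :: "real \<Rightarrow> real"
  assumes traj: "P6_P2_trajectory d l r x2 \<sigma> w"
begin

definition G where "G x = q (w x) / ((\<sigma> x)\<^sup>2 - (1 - w x)\<^sup>2)"

lemma
  assumes "x < x2"
  shows der_\<sigma>: "(\<sigma> has_real_derivative deriv \<sigma> x) (at x)"
    and der_w: "(w has_real_derivative deriv w x) (at x)"
    and ode_w: "Delta (\<sigma> x) (w x) * deriv w x = - Delta1 d l r (\<sigma> x) (w x)"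
    and ode_\<sigma>: "Delta (\<sigma> x) (w x) * deriv \<sigma> x = - Delta2 d l r (\<sigma> x) (w x)"
  using traj assms by (auto simp: P6_P2_trajectory_def DERIV_deriv_iff_real_differentiable)

lemma limits:
  "filterlim \<sigma> at_top at_bot" "(w \<longlongrightarrow> w_e d l r) at_bot"
  "(\<sigma> \<longlongrightarrow> sigma2 d l r) (at_left x2)" "(w \<longlongrightarrow> w2 d l r) (at_left x2)"
  using traj by (auto simp: P6_P2_trajectory_def)

lemma sigma_gt:
  assumes "x < x2"
  shows "sigma2 d l r < \<sigma> x"
proof -
  obtain W where W: "(\<lambda>x. (\<sigma> x, w x)) ` {..<x2} = (\<lambda>s. (s, W s)) ` {sigma2 d l r<..}"
    using traj by (auto simp: P6_P2_trajectory_def)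
  have "(\<sigma> x, w x) \<in> (\<lambda>x. (\<sigma> x, w x)) ` {..<x2}" using assms by blast
  then show ?thesis unfolding W by auto
qed

text \<open>
  The sonic lines can be met only where \<open>q\<close> vanishes, that is, at \<open>w = w\<^sub>2\<close> or \<open>w = w\<^sub>3\<close>, and there
  \<open>\<sigma> = 1 - w\<close> is at most \<open>\<sigma>\<^sub>2\<close>.
\<close>

lemma not_sonic:
  assumes "x < x2"
  shows "(\<sigma> x)\<^sup>2 \<noteq> (1 - w x)\<^sup>2"
proof
  assume eq: "(\<sigma> x)\<^sup>2 = (1 - w x)\<^sup>2"
  have s: "0 < \<sigma> x" "sigma2 d l r < \<sigma> x" using sigma_gt[OF assms] sigma2_pos by auto
  have "Delta (\<sigma> x) (w x) = 0" using eq by (simp add: Delta_def power2_eq_square algebra_simps)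
  then have "(1 - w x) * q (w x) = 0" using ode_w[OF assms] eq by (simp add: Delta1_eq)
  moreover have "w x \<noteq> 1" using eq s by auto
  ultimately have "w x = w2 d l r \<or> w x = w3 d l r" using n_gt by (auto simp: q_factor)
  then have "0 < 1 - w x" "1 - w x \<le> sigma2 d l r"
    using w2_less_w3 w3_less_1 by (auto simp: sigma2_def)
  then show False using eq s power2_eq_iff[of "\<sigma> x" "1 - w x"] by auto
qed

lemma eventually_before:
  assumes "eventually Q (at_bot :: real filter)"
  obtains a where "a < x" "Q a"
proof -
  have "eventually (\<lambda>a. a < x \<and> Q a) at_bot"
    using eventually_conj[OF eventually_gt_at_bot[of x] assms] by simp
  then have "\<exists>a. a < x \<and> Q a"
    by (rule eventually_happens'[OF trivial_limit_at_bot_linorder])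
  then show ?thesis using that by blast
qed

lemma cont_\<sigma>: "b < x2 \<Longrightarrow> continuous_on {a..b} \<sigma>"
  by (intro continuous_at_imp_continuous_on ballI DERIV_isCont[OF der_\<sigma>]) auto

lemma cont_w: "b < x2 \<Longrightarrow> continuous_on {a..b} w"
  by (intro continuous_at_imp_continuous_on ballI DERIV_isCont[OF der_w]) auto

lemma supersonic:
  assumes x: "x < x2"
  shows "(1 - w x)\<^sup>2 < (\<sigma> x)\<^sup>2"
proof (rule ccontr)
  assume "\<not> (1 - w x)\<^sup>2 < (\<sigma> x)\<^sup>2"
  then have neg: "(\<sigma> x)\<^sup>2 - (1 - w x)\<^sup>2 \<le> 0" by simp
  have "\<forall>\<^sub>F a in at_bot. \<bar>1 - w_e d l r\<bar> + 1 < \<sigma> a \<and> \<bar>w a - w_e d l r\<bar> < 1"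
    using filterlim_at_top_dense[THEN iffD1, OF limits(1)] tendstoD[OF limits(2), of 1]
    by (auto simp: dist_real_def intro: eventually_conj)
  then obtain a where a: "a < x" "\<bar>1 - w_e d l r\<bar> + 1 < \<sigma> a" "\<bar>w a - w_e d l r\<bar> < 1"
    by (rule eventually_before[of _ x]) auto
  then have "\<bar>1 - w a\<bar> < \<bar>\<sigma> a\<bar>" by linarith
  then have "(\<sigma> a)\<^sup>2 - (1 - w a)\<^sup>2 \<ge> 0" by (simp flip: abs_le_square_iff)
  then have "\<exists>t\<ge>a. t \<le> x \<and> (\<sigma> t)\<^sup>2 - (1 - w t)\<^sup>2 = 0"
    using neg a x by (intro IVT2' continuous_intros cont_\<sigma> cont_w) auto
  then show False using not_sonic x by force
qed

lemma
  assumes "x < x2"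
  shows gap_pos: "0 < \<sigma> x - (1 - w x)" and sum_pos: "0 < \<sigma> x + (1 - w x)"
proof -
  have "\<bar>1 - w x\<bar> < \<bar>\<sigma> x\<bar>" using supersonic[OF assms] abs_le_square_iff[of "\<sigma> x" "1 - w x"] by linarith
  then show "0 < \<sigma> x - (1 - w x)" "0 < \<sigma> x + (1 - w x)"
    using sigma_gt[OF assms] sigma2_pos by linarith+
qed

lemma w_velocity:
  assumes "x < x2"
  shows "deriv w x = (1 - w x) * G x - n * (w x - w_e d l r)"
proof -
  define h where "h = (\<sigma> x)\<^sup>2 - (1 - w x)\<^sup>2"
  have h: "0 < h" using supersonic[OF assms] by (simp add: h_def)
  have "Delta (\<sigma> x) (w x) = - h" by (simp add: Delta_def h_def power2_eq_square algebra_simps)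
  then have "h * deriv w x = (1 - w x) * q (w x) - n * (w x - w_e d l r) * h"
    using ode_w[OF assms] unfolding Delta1_eq h_def[symmetric]
    by simp
  then show ?thesis using h unfolding G_def h_def[symmetric] by (simp add: field_simps)
qed

lemma \<sigma>_velocity:
  assumes "x < x2"
  shows "deriv \<sigma> x = - \<sigma> x + \<sigma> x * G x / l"
proof -
  define h where "h = (\<sigma> x)\<^sup>2 - (1 - w x)\<^sup>2"
  have h: "0 < h" using supersonic[OF assms] by (simp add: h_def)
  have "Delta (\<sigma> x) (w x) = - h" by (simp add: Delta_def h_def power2_eq_square algebra_simps)
  then have "h * deriv \<sigma> x = \<sigma> x / l * (q (w x) - l * h)"
    using ode_\<sigma>[OF assms] unfolding Delta2_eq h_def[symmetric]
    by simp
  then show ?thesis using h l_pos unfolding G_def h_def[symmetric] by (simp add: field_simps)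
qed

text \<open>On the line \<open>w = w\<^sub>2\<close> one has \<open>G = 0\<close>, so \<open>w\<close> can only decrease through it.\<close>

lemma w_less_w2:
  assumes x: "x < x2"
  shows "w x < w2 d l r"
proof -
  have "\<forall>\<^sub>F a in at_bot. w a < w2 d l r"
    using order_tendstoD(2)[OF limits(2) w_e_less_w2] .
  then obtain a where a: "a < x" "w a < w2 d l r" by (rule eventually_before)
  show ?thesis
  proof (rule stays_below_level[of a x2 w "deriv w"])
    fix t assume t: "a < t" "t < x2" "w t = w2 d l r"
    then have "deriv w t = - (n * (w2 d l r - w_e d l r))"
      by (simp add: w_velocity G_def q_factor)
    then show "deriv w t < 0" using n_gt w_e_less_w2 by simp
  qed (use a x der_w in auto)
qed

lemma G_pos:
  assumes "x < x2"
  shows "0 < G x"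
  using q_pos[OF w_less_w2[OF assms]] supersonic[OF assms] by (simp add: G_def)

lemma w_less_1: "x < x2 \<Longrightarrow> w x < 1"
  using w_less_w2 w2_less_w3 w3_less_1 by fastforce

text \<open>
  A barrier argument would need \<open>w > w\<^sub>e\<close> at some starting point, which the limit \<open>w \<rightarrow> w\<^sub>e\<close> does not
  provide. Instead, \<open>e\<^bsup>n x\<^esup> (w - w\<^sub>e)\<close> increases from its limit \<open>0\<close> at \<open>P\<^sub>6\<close>, with derivative
  \<open>e\<^bsup>n x\<^esup> (1 - w) G\<close>.
\<close>

lemma w_greater_w_e:
  assumes x: "x < x2"
  shows "w_e d l r < w x"
proof -
  define f where "f t = exp (n * t) * (w t - w_e d l r)" for t
  have der: "(f has_real_derivative exp (n * t) * ((1 - w t) * G t)) (at t)" if "t < x2" for t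
    unfolding f_def using der_w[OF that]
    by (auto intro!: derivative_eq_intros simp: w_velocity[OF that] algebra_simps)
  have inc: "f s < f t" if "s < t" "t < x2" for s t
  proof (rule DERIV_pos_imp_increasing[OF that(1)])
    fix c assume "s \<le> c" "c \<le> t"
    then have "c < x2" using that by simp
    moreover from this have "0 < exp (n * c) * ((1 - w c) * G c)"
      using G_pos[of c] w_less_1[of c] by simp
    ultimately show "\<exists>y. (f has_real_derivative y) (at c) \<and> 0 < y"
      using der[of c] by blast
  qed
  have lim: "(f \<longlongrightarrow> 0 * (w_e d l r - w_e d l r)) at_bot"
    unfolding f_def
  proof (intro tendsto_mult tendsto_diff limits(2) tendsto_const)
    have "filterlim (\<lambda>t. n * t) at_bot at_bot"
      using n_gt by (intro filterlim_tendsto_pos_mult_at_bot[OF tendsto_const _ filterlim_ident]) simp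
    then show "((\<lambda>t. exp (n * t)) \<longlongrightarrow> 0) at_bot"
      by (rule filterlim_compose[OF exp_at_bot])
  qed
  have "0 \<le> f (x - 1)"
  proof (rule tendsto_upperbound)
    show "(f \<longlongrightarrow> 0) at_bot" using lim by simp
    show "\<forall>\<^sub>F t in at_bot. f t \<le> f (x - 1)"
      using eventually_gt_at_bot[of "x - 1"] by eventually_elim (use inc[of _ "x - 1"] x in force)
  qed simp
  also have "\<dots> < f x" using inc[of "x - 1" x] x by simp
  finally show ?thesis by (simp add: f_def zero_less_mult_iff)
qed

text \<open>
  The function \<open>q Q - (P - \<eta>) D S\<close>: on the trajectory it is negative exactly if
  \<open>A - F > \<eta>\<close>, and unlike \<open>G Q - P\<close> it is a polynomial in \<open>\<sigma>\<close> and \<open>w\<close>.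
\<close>

definition barrier where
  "barrier x = (n - 1) * (w2 d l r - w x) * (w3 d l r - w x) * (1 - w x + \<sigma> x / l)
    - ((1 - w x) + n * (w x - w_e d l r) - barrier_gap)
      * ((\<sigma> x - (1 - w x)) * (\<sigma> x + (1 - w x)))"

definition barrier_deriv where
  "barrier_deriv x = - (n - 1) * ((w2 d l r - w x) + (w3 d l r - w x)) * deriv w x * (1 - w x + \<sigma> x / l)
    + (n - 1) * (w2 d l r - w x) * (w3 d l r - w x) * (- deriv w x + deriv \<sigma> x / l)
    - (n - 1) * deriv w x * ((\<sigma> x - (1 - w x)) * (\<sigma> x + (1 - w x)))
    - ((1 - w x) + n * (w x - w_e d l r) - barrier_gap)
      * ((deriv \<sigma> x + deriv w x) * (\<sigma> x + (1 - w x)) + (\<sigma> x - (1 - w x)) * (deriv \<sigma> x - deriv w x))"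

lemma barrier_has_derivative:
  assumes "x < x2"
  shows "(barrier has_real_derivative barrier_deriv x) (at x)"
  unfolding barrier_def barrier_deriv_def using der_w[OF assms] der_\<sigma>[OF assms] l_pos
  by (auto intro!: derivative_eq_intros) (simp add: algebra_simps)

text \<open>Divided by \<open>\<sigma>\<^sup>2\<close>, the barrier function tends to \<open>- (1 - w\<^sub>e - \<eta>)\<close> at \<open>P\<^sub>6\<close>.\<close>

lemma barrier_negative_at_infinity: "\<forall>\<^sub>F x in at_bot. barrier x < 0"
proof -
  define i where "i x = inverse (\<sigma> x)" for x
  have i: "(i \<longlongrightarrow> 0) at_bot"
    unfolding i_def by (rule tendsto_inverse_0_at_top[OF limits(1)])
  define e where "e = w_e d l r"
  define m where "m x = (n - 1) * (w2 d l r - w x) * (w3 d l r - w x) * ((1 - w x) * (i x)\<^sup>2 + i x / l)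
    - ((1 - w x) + n * (w x - e) - barrier_gap) * ((1 - (1 - w x) * i x) * (1 + (1 - w x) * i x))" for x
  have "(m \<longlongrightarrow> (n - 1) * (w2 d l r - e) * (w3 d l r - e) * ((1 - e) * 0\<^sup>2 + 0 / l)
    - ((1 - e) + n * (e - e) - barrier_gap) * ((1 - (1 - e) * 0) * (1 + (1 - e) * 0))) at_bot"
    unfolding m_def using l_pos by (intro tendsto_intros i limits(2)[folded e_def]) auto
  then have "(m \<longlongrightarrow> - (1 - e - barrier_gap)) at_bot" by simp
  moreover have "- (1 - e - barrier_gap) < 0"
    using barrier_gap(2) w_e_less_w2 w2_less_w3 by (simp add: e_def)
  ultimately have m: "\<forall>\<^sub>F x in at_bot. m x < 0" by (rule order_tendstoD)
  have s: "\<forall>\<^sub>F x in at_bot. 0 < \<sigma> x"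
    using filterlim_at_top_dense[THEN iffD1, OF limits(1)] by blast
  show ?thesis using m s
  proof eventually_elim
    case (elim x)
    have si: "\<sigma> x * i x = 1" using elim by (simp add: i_def)
    have "1 - w x + \<sigma> x / l = (\<sigma> x)\<^sup>2 * ((1 - w x) * (i x)\<^sup>2 + i x / l)"
      using elim l_pos by (simp add: i_def field_simps power2_eq_square)
    moreover have "(\<sigma> x - (1 - w x)) * (\<sigma> x + (1 - w x))
      = (\<sigma> x)\<^sup>2 * ((1 - (1 - w x) * i x) * (1 + (1 - w x) * i x))"
      using elim by (simp add: i_def field_simps power2_eq_square)
    ultimately have "barrier x = (\<sigma> x)\<^sup>2 * m x"
      unfolding barrier_def m_def e_def by (simp only: right_diff_distrib mult_ac)
    then show "barrier x < 0" using elim by (simp add: mult_pos_neg)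
  qed
qed

lemma barrier_crossing:
  assumes x: "x < x2" and 0: "barrier x = 0"
  shows "barrier_deriv x < 0"
proof -
  define P Q where "P = (1 - w x) + n * (w x - w_e d l r) - barrier_gap"
    and "Q = 1 - w x + \<sigma> x / l"
  have Q0: "0 < Q" using w_less_1[OF x] sigma_gt[OF x] sigma2_pos l_pos
    by (simp add: Q_def add_pos_pos)
  have on: "(n - 1) * (w2 d l r - w x) * (w3 d l r - w x) * Q
    = P * ((\<sigma> x - (1 - w x)) * (\<sigma> x + (1 - w x)))"
    using 0 by (simp add: barrier_def P_def Q_def)
  have sq: "(\<sigma> x)\<^sup>2 - (1 - w x)\<^sup>2 = (\<sigma> x - (1 - w x)) * (\<sigma> x + (1 - w x))"
    by (simp add: power2_eq_square algebra_simps)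
  have G: "G x = P / Q"
    using on Q0 gap_pos[OF x] sum_pos[OF x] unfolding G_def sq q_factor
    by (simp add: frac_eq_eq)
  have ws: "l * (1 - w x) - n * (w x - w_e d l r)
    = (l + n) * ((w2 d l r - w x) + (w5 d l r - w2 d l r))"
  proof -
    have "(l + n) * w5 d l r = l * r" using l_pos n_gt by (simp add: w5_def add.commute[of l])
    then show ?thesis using n_w_e by (simp add: algebra_simps)
  qed
  show ?thesis
    unfolding barrier_deriv_def P_def[symmetric] Q_def[symmetric]
  proof (rule barrier_derivative_negative[OF l_pos n_gt _ _ _ _ barrier_gap(1) _ _ ws
        barrier_gap_small[OF w_less_w2[OF x]] Q_def P_def on])
    show "deriv w x = (1 - w x) * (P / Q) - n * (w x - w_e d l r)"
      using w_velocity[OF x] G by simp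
    show "deriv \<sigma> x = - \<sigma> x + \<sigma> x * (P / Q) / l"
      using \<sigma>_velocity[OF x] G by simp
  qed (use w_less_w2[OF x] w2_less_w3 barrier_gap(2) w_greater_w_e[OF x] w_e_pos gap_pos[OF x] n_gt in auto)
qed

lemma barrier_negative:
  assumes x: "x < x2"
  shows "barrier x < 0"
proof -
  obtain a where "a < x" "barrier a < 0" by (rule eventually_before[OF barrier_negative_at_infinity])
  then show ?thesis
    using x barrier_crossing by (intro stays_below_level[of a x2 barrier barrier_deriv 0 x] barrier_has_derivative) auto
qed

lemma repulsivity_gap:
  assumes x: "x < x2"
  shows "barrier_gap < (1 - w x - deriv w x) - (\<sigma> x + deriv \<sigma> x)"
proof -
  define h P Q where "h = (\<sigma> x - (1 - w x)) * (\<sigma> x + (1 - w x))"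
    and "P = (1 - w x) + n * (w x - w_e d l r) - barrier_gap" and "Q = 1 - w x + \<sigma> x / l"
  have h: "0 < h" using gap_pos[OF x] sum_pos[OF x] by (simp add: h_def)
  have sq: "(\<sigma> x)\<^sup>2 - (1 - w x)\<^sup>2 = h"
    by (simp add: h_def power2_eq_square algebra_simps)
  have "q (w x) * Q < P * h"
    using barrier_negative[OF x] by (simp add: barrier_def q_factor h_def P_def Q_def)
  then have "G x * Q < P" using h unfolding G_def sq by (simp add: pos_divide_less_eq)
  then show ?thesis
    unfolding w_velocity[OF x] \<sigma>_velocity[OF x] P_def Q_def by (simp add: algebra_simps)
qed

end

section \<open>Arrival at the sonic point\<close>

context trajectory
begin

text \<open>
  The value of \<open>y G' / G\<close>, with \<open>y = w\<^sub>2 - w\<close>, at a point where \<open>G\<close> equals \<open>g\<close>. The factor \<open>y\<close>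
  removes the singularity of \<open>G' / G\<close> at \<open>P\<^sub>2\<close>: there \<open>y / D\<close> is expressed through \<open>G\<close> itself, as
  \<open>G S / ((n - 1) z)\<close>.
\<close>

definition growth_rate :: "real \<Rightarrow> real \<Rightarrow> real" where
  "growth_rate g x = (let W = (1 - w x) * g - n * (w x - w_e d l r); V = - \<sigma> x + \<sigma> x * g / l;
      y = w2 d l r - w x; z = w3 d l r - w x; S = \<sigma> x + (1 - w x)
    in - W * (1 + y / z) - g * S / ((n - 1) * z) * (V + W) - y * (V - W) / S)"

lemma G_deriv:
  assumes x: "x < x2"
  shows "(G has_real_derivative G x / (w2 d l r - w x) * growth_rate (G x) x) (at x)"
proof -
  define y z D S W V where "y = w2 d l r - w x" and "z = w3 d l r - w x"
    and "D = \<sigma> x - (1 - w x)" and "S = \<sigma> x + (1 - w x)" and "W = deriv w x" and "V = deriv \<sigma> x"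
  have pos: "0 < y" "0 < z" "0 < D" "0 < S"
    using w_less_w2[OF x] w2_less_w3 gap_pos[OF x] sum_pos[OF x]
    by (simp_all add: y_def z_def D_def S_def)
  have Geq: "G = (\<lambda>t. (n - 1) * (w2 d l r - w t) * (w3 d l r - w t)
      / ((\<sigma> t - (1 - w t)) * (\<sigma> t + (1 - w t))))"
    by (rule ext) (simp add: G_def q_factor power2_eq_square algebra_simps)
  have Gx: "G x = (n - 1) * y * z / (D * S)"
    unfolding Geq y_def z_def D_def S_def ..
  have num: "((\<lambda>t. (n - 1) * (w2 d l r - w t) * (w3 d l r - w t)) has_real_derivative
    - (n - 1) * W * (y + z)) (at x)"
    using der_w[OF x] unfolding W_def y_def z_def
    by (auto intro!: derivative_eq_intros simp: algebra_simps)
  have den: "((\<lambda>t. (\<sigma> t - (1 - w t)) * (\<sigma> t + (1 - w t))) has_real_derivative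
    ((V + W) * S + D * (V - W))) (at x)"
    using der_w[OF x] der_\<sigma>[OF x] unfolding W_def V_def D_def S_def
    by (auto intro!: derivative_eq_intros simp: algebra_simps)
  have "(G has_real_derivative ((- (n - 1) * W * (y + z)) * (D * S)
      - (n - 1) * y * z * ((V + W) * S + D * (V - W))) / ((D * S) * (D * S))) (at x)"
    using DERIV_divide[OF num den] pos unfolding Geq[symmetric]
    by (simp add: y_def[symmetric] z_def[symmetric] D_def[symmetric] S_def[symmetric])
  moreover have "((- (n - 1) * W * (y + z)) * (D * S)
      - (n - 1) * y * z * ((V + W) * S + D * (V - W))) / ((D * S) * (D * S))
    = G x / y * (- W * (1 + y / z) - G x * S / ((n - 1) * z) * (V + W) - y * (V - W) / S)"
  proof -
    have e1: "G x / y * (W * (1 + y / z)) = (n - 1) * W * (y + z) * (D * S) / ((D * S) * (D * S))"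
      unfolding Gx using pos by (simp add: field_simps)
    have e2: "G x / y * (G x * S / ((n - 1) * z) * (V + W))
      = (n - 1) * y * z * ((V + W) * S) / ((D * S) * (D * S))"
      unfolding Gx using pos n_gt by (simp add: mult_ac)
    have e3: "G x / y * (y * (V - W) / S) = (n - 1) * y * z * (D * (V - W)) / ((D * S) * (D * S))"
      unfolding Gx using pos by (simp add: mult_ac)
    have dist: "k * (- W * a - b - c) = - (k * (W * a)) - k * b - k * c" for k a b c :: real
      by (simp add: algebra_simps)
    have split: "(- m * W * b * c - N * (p + t)) / H = - (m * W * b * c / H) - N * p / H - N * t / H"
      for m b c N p t H :: real
      by (simp add: diff_divide_distrib add_divide_distrib distrib_left)
    show ?thesis unfolding dist split e1 e2 e3 ..
  qed
  moreover have "growth_rate (G x) x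
    = - W * (1 + y / z) - G x * S / ((n - 1) * z) * (V + W) - y * (V - W) / S"
    unfolding growth_rate_def Let_def W_def V_def w_velocity[OF x] \<sigma>_velocity[OF x]
      y_def z_def S_def ..
  ultimately show ?thesis unfolding y_def by simp
qed

lemma growth_rate_tendsto:
  defines "s \<equiv> sigma2 d l r" and "\<delta> \<equiv> n * (w2 d l r - w_e d l r)"
    and "k \<equiv> 2 * sigma2 d l r / ((n - 1) * (w3 d l r - w2 d l r))"
  shows "(growth_rate g \<longlongrightarrow> poly [:\<delta>, k * (s + \<delta>) - s, - k * (s + s / l):] g) (at_left x2)"
proof -
  have u: "1 - w2 d l r = s" by (simp add: s_def sigma2_def)
  have s0: "0 < s" using sigma2_pos by (simp add: s_def)
  have "(growth_rate g \<longlongrightarrow>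
    - (s * g - \<delta>) * (1 + (w2 d l r - w2 d l r) / (w3 d l r - w2 d l r))
    - g * (s + s) / ((n - 1) * (w3 d l r - w2 d l r)) * ((- s + s * g / l) + (s * g - \<delta>))
    - (w2 d l r - w2 d l r) * ((- s + s * g / l) - (s * g - \<delta>)) / (s + s)) (at_left x2)"
    unfolding growth_rate_def Let_def \<delta>_def u[symmetric]
    using n_gt w2_less_w3 l_pos s0
    by (intro tendsto_intros limits(3)[folded s_def, folded u] limits(4)) (auto simp: u)
  also have "- (s * g - \<delta>) * (1 + (w2 d l r - w2 d l r) / (w3 d l r - w2 d l r))
    - g * (s + s) / ((n - 1) * (w3 d l r - w2 d l r)) * ((- s + s * g / l) + (s * g - \<delta>))
    - (w2 d l r - w2 d l r) * ((- s + s * g / l) - (s * g - \<delta>)) / (s + s)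
    = - (s * g - \<delta>) - g * k * ((- s + s * g / l) + (s * g - \<delta>))"
    by (simp add: k_def s_def)
  also have "\<dots> = poly [:\<delta>, k * (s + \<delta>) - s, - k * (s + s / l):] g"
    by (simp add: algebra_simps power2_eq_square)
  finally show ?thesis .
qed

text \<open>
  For a fixed level \<open>g\<close> the growth rate converges to a polynomial in \<open>g\<close>, nonzero because its
  constant coefficient is \<open>n (w\<^sub>2 - w\<^sub>e) > 0\<close>. Where this polynomial does not vanish, the sign of
  \<open>G'\<close> at the level \<open>g\<close> is eventually constant.
\<close>

lemma G_converges: "\<exists>L. (G \<longlongrightarrow> L) (at_left x2)"
proof -
  have before: "\<forall>\<^sub>F x in at_left x2. x < x2"
    by (simp add: eventually_at_filter)
  define p where "p = [:n * (w2 d l r - w_e d l r),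
      2 * sigma2 d l r / ((n - 1) * (w3 d l r - w2 d l r)) * (sigma2 d l r + n * (w2 d l r - w_e d l r)) - sigma2 d l r,
      - (2 * sigma2 d l r / ((n - 1) * (w3 d l r - w2 d l r))) * (sigma2 d l r + sigma2 d l r / l):]"
  have p0: "p \<noteq> 0" using n_gt w_e_less_w2 by (simp add: p_def)
  have lim: "(growth_rate g \<longlongrightarrow> poly p g) (at_left x2)" for g
    unfolding p_def by (rule growth_rate_tendsto)
  show ?thesis
  proof (rule converges_if_one_sided_levels[OF G_deriv, where A = 0 and Z = "{g. poly p g = 0}"
        and B = "(1 + n) / sigma2 d l r"])
    show "\<forall>\<^sub>F x in at_left x2. 0 < G x"
      using before by eventually_elim (rule G_pos)
    show "\<forall>\<^sub>F x in at_left x2. G x < (1 + n) / sigma2 d l r"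
      using before
    proof eventually_elim
      case (elim x)
      have "1 - w x - deriv w x - (\<sigma> x + deriv \<sigma> x)
        = (1 - w x) + n * (w x - w_e d l r) - G x * (1 - w x + \<sigma> x / l)"
        unfolding w_velocity[OF elim] \<sigma>_velocity[OF elim] by (simp add: algebra_simps)
      then have "G x * (1 - w x + \<sigma> x / l) < (1 - w x) + n * (w x - w_e d l r)"
        using repulsivity_gap[OF elim] barrier_gap(1) by linarith
      also have "\<dots> < 1 + n * 1"
        using w_less_1[OF elim] w_greater_w_e[OF elim] w_e_pos n_gt
        by (intro add_strict_mono mult_strict_left_mono) auto
      finally have "G x * (1 - w x + \<sigma> x / l) < 1 + n" by simp
      moreover have "G x * sigma2 d l r \<le> G x * (1 - w x + \<sigma> x / l)"
      proof (rule mult_left_mono)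
        have "0 \<le> \<sigma> x / l" using sigma_gt[OF elim] sigma2_pos l_pos by simp
        then show "sigma2 d l r \<le> 1 - w x + \<sigma> x / l"
          using w_less_w2[OF elim] by (simp add: sigma2_def)
      qed (use G_pos[OF elim] in simp)
      ultimately show ?case using sigma2_pos by (simp add: pos_less_divide_eq)
    qed
    show "finite {g. poly p g = 0}" using p0 by (rule poly_roots_finite)
  next
    fix g :: real assume g: "0 < g" "g \<notin> {g. poly p g = 0}"
    then have "poly p g < 0 \<or> 0 < poly p g" by auto
    then show "(\<forall>\<^sub>F x in at_left x2. G x = g \<longrightarrow> G x / (w2 d l r - w x) * growth_rate (G x) x < 0)
      \<or> (\<forall>\<^sub>F x in at_left x2. G x = g \<longrightarrow> 0 < G x / (w2 d l r - w x) * growth_rate (G x) x)"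
    proof
      assume "poly p g < 0"
      then have "\<forall>\<^sub>F x in at_left x2. growth_rate g x < 0" by (rule order_tendstoD(2)[OF lim])
      then have "\<forall>\<^sub>F x in at_left x2. G x = g \<longrightarrow> G x / (w2 d l r - w x) * growth_rate (G x) x < 0"
        using before by eventually_elim (use w_less_w2 g in \<open>auto intro!: divide_neg_pos mult_pos_neg\<close>)
      then show ?thesis ..
    next
      assume "0 < poly p g"
      then have "\<forall>\<^sub>F x in at_left x2. 0 < growth_rate g x" by (rule order_tendstoD(1)[OF lim])
      then have "\<forall>\<^sub>F x in at_left x2. G x = g \<longrightarrow> 0 < G x / (w2 d l r - w x) * growth_rate (G x) x"
        using before by eventually_elim (use w_less_w2 g in auto)
      then show ?thesis ..
    qed
  qed
qed

lemma repulsive_along: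
  assumes x: "x < x2"
  shows "repulsive (min barrier_gap (barrier_gap\<^sup>2)) (\<sigma> x) (w x) (deriv \<sigma> x) (deriv w x)"
proof (rule repulsiveI[OF barrier_gap(1)])
  show "0 < \<sigma> x" using sigma_gt[OF x] sigma2_pos by simp
  then show "0 \<le> \<sigma> x + deriv \<sigma> x"
    using G_pos[OF x] l_pos by (simp add: \<sigma>_velocity[OF x])
qed (use w_less_1[OF x] gap_pos[OF x] repulsivity_gap[OF x] in auto)

lemma repulsive_at_end:
  obtains \<sigma>2' w2' where "(deriv \<sigma> \<longlongrightarrow> \<sigma>2') (at_left x2)" "(deriv w \<longlongrightarrow> w2') (at_left x2)"
    "repulsive (min barrier_gap (barrier_gap\<^sup>2)) (sigma2 d l r) (w2 d l r) \<sigma>2' w2'"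
proof -
  have before: "\<forall>\<^sub>F x in at_left x2. x < x2"
    by (simp add: eventually_at_filter)
  obtain L where L: "(G \<longlongrightarrow> L) (at_left x2)" using G_converges by blast
  define A B where "A = - sigma2 d l r + sigma2 d l r * L / l"
    and "B = (1 - w2 d l r) * L - n * (w2 d l r - w_e d l r)"
  have "((\<lambda>x. - \<sigma> x + \<sigma> x * G x / l) \<longlongrightarrow> A) (at_left x2)"
    unfolding A_def using l_pos by (intro tendsto_intros limits L) auto
  then have A: "(deriv \<sigma> \<longlongrightarrow> A) (at_left x2)"
    by (rule Lim_transform_eventually) (use before in eventually_elim, simp add: \<sigma>_velocity)
  have "((\<lambda>x. (1 - w x) * G x - n * (w x - w_e d l r)) \<longlongrightarrow> B) (at_left x2)"
    unfolding B_def by (intro tendsto_intros limits L)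
  then have B: "(deriv w \<longlongrightarrow> B) (at_left x2)"
    by (rule Lim_transform_eventually) (use before in eventually_elim, simp add: w_velocity)
  have "repulsive (min barrier_gap (barrier_gap\<^sup>2)) (sigma2 d l r) (w2 d l r) A B"
  proof (rule repulsiveI[OF barrier_gap(1)])
    have "((\<lambda>x. \<sigma> x + deriv \<sigma> x) \<longlongrightarrow> sigma2 d l r + A) (at_left x2)"
      by (intro tendsto_intros limits A)
    moreover have "\<forall>\<^sub>F x in at_left x2. 0 \<le> \<sigma> x + deriv \<sigma> x"
      using before
    proof eventually_elim
      case (elim x)
      then show ?case using sigma_gt[OF elim] sigma2_pos G_pos[OF elim] l_pos by (simp add: \<sigma>_velocity)
    qed
    ultimately show "0 \<le> sigma2 d l r + A" by (rule tendsto_lowerbound) simp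
    have "((\<lambda>x. (1 - w x - deriv w x) - (\<sigma> x + deriv \<sigma> x))
        \<longlongrightarrow> (1 - w2 d l r - B) - (sigma2 d l r + A)) (at_left x2)"
      by (intro tendsto_intros limits A B)
    moreover have "\<forall>\<^sub>F x in at_left x2. barrier_gap \<le> (1 - w x - deriv w x) - (\<sigma> x + deriv \<sigma> x)"
      using before by eventually_elim (use repulsivity_gap in \<open>auto intro: less_imp_le\<close>)
    ultimately show "barrier_gap \<le> (1 - w2 d l r - B) - (sigma2 d l r + A)"
      by (rule tendsto_lowerbound) simp
  qed (use sigma2_pos in \<open>auto simp: sigma2_def\<close>)
  then show ?thesis using that A B by blast
qed

end

theorem lemma1p5:
  fixes d :: nat
  assumes "d \<ge> 2"
  shows "\<exists>\<epsilon> :: real \<Rightarrow> real. (\<forall>l>0. 0 < \<epsilon> l \<and> \<epsilon> l < 1) \<and>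
    (\<forall>l r. r > 1 \<and> admissible_range d \<epsilon> l r \<longrightarrow>
      (\<exists>c>0. \<forall>x2 \<sigma> w. P6_P2_trajectory d l r x2 \<sigma> w \<longrightarrow>
         (\<forall>x<x2. repulsive c (\<sigma> x) (w x) (deriv \<sigma> x) (deriv w x)) \<and>
         (\<exists>\<sigma>2' w2'. (deriv \<sigma> \<longlongrightarrow> \<sigma>2') (at_left x2) \<and> (deriv w \<longlongrightarrow> w2') (at_left x2) \<and>
            repulsive c (sigma2 d l r) (w2 d l r) \<sigma>2' w2')))"
proof (intro exI[of _ "\<lambda>_. 1 / 2"] conjI allI impI)
  show "0 < (1 / 2 :: real)" "(1 / 2 :: real) < 1" by simp_all
next
  fix l r :: real
  assume lr: "1 < r \<and> admissible_range d (\<lambda>_. 1 / 2) l r"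
  then interpret subcritical d l r
    using assms subcritical_if_below_r_star subcritical_if_below_r_plus
    unfolding admissible_range_def by blast
  define c where "c = min barrier_gap (barrier_gap\<^sup>2)"
  have "0 < c" using barrier_gap(1) by (simp add: c_def)
  moreover have "(\<forall>x<x2. repulsive c (\<sigma> x) (w x) (deriv \<sigma> x) (deriv w x)) \<and>
     (\<exists>\<sigma>2' w2'. (deriv \<sigma> \<longlongrightarrow> \<sigma>2') (at_left x2) \<and> (deriv w \<longlongrightarrow> w2') (at_left x2) \<and>
        repulsive c (sigma2 d l r) (w2 d l r) \<sigma>2' w2')"
    if "P6_P2_trajectory d l r x2 \<sigma> w" for x2 \<sigma> w
  proof -
    interpret trajectory d l r x2 \<sigma> w by unfold_locales (fact that)
    show ?thesis unfolding c_def using repulsive_along repulsive_at_end by metis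
  qed
  ultimately show "\<exists>c>0. \<forall>x2 \<sigma> w. P6_P2_trajectory d l r x2 \<sigma> w \<longrightarrow>
       (\<forall>x<x2. repulsive c (\<sigma> x) (w x) (deriv \<sigma> x) (deriv w x)) \<and>
       (\<exists>\<sigma>2' w2'. (deriv \<sigma> \<longlongrightarrow> \<sigma>2') (at_left x2) \<and> (deriv w \<longlongrightarrow> w2') (at_left x2) \<and>
          repulsive c (sigma2 d l r) (w2 d l r) \<sigma>2' w2')"
    by blast
qed

end
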